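(* Let $S$ be a left cancellative monoid, let $\mathcal G=\mathcal G_P(S)$ and $Y=\{\chi_s: s\in S\}\subseteq\Omega(S)=\mathcal G^{(0)}$. Then the following are equivalent: (a) for every $\chi\in\partial\Omega(S)\setminus Y$, Condition (C) below fails for $x=\chi$; (b) $S$ is strongly C$^*$-regular on the boundary. Condition (C) for $x$: for some $n\ge1$ there are elements $g_1,\dots,g_n\in\mathcal G_x^x\setminus\{x\}$, open bisections $U_1,\dots,U_n$ of $\mathcal G$ with $g_k\in U_k$ for all $k$, and a neighbourhood $U$ of $x$ in $\mathcal G^{(0)}$ such that $Y\cap U\subseteq U_1\cup\dots\cup U_n$.
   Context: $S$ is a left cancellative monoid with identity $e$ ($st=st'\Rightarrow t=t'$). Identify $s\in S$ with the injection $S\to S$, $t\mapsto st$, and let $s^{-1}$ be the inverse partial bijection $sS\to S$. $I_\ell(S)$ is the inverse semigroup of partial bijections of $S$ generated by the left translations; its elements are the compositions $s_{2n}^{-1}s_{2n-1}\cdots s_2^{-1}s_1$. $\mathcal J(S)=\{\operatorname{dom} g: g\in I_\ell(S)\}$ is the set of constructible right ideals, a semigroup under intersection. $p_X$ is the identity map on $X\subseteq S$. "$hs=s$" means $s\in\operatorname{dom}h$ and $h(s)=s$; "$hp_Z=p_Z$" means $Z\subseteq\operatorname{dom}h$ and $h$ fixes every point of $Z$. A finite family $\{X_1,\dots,X_m\}\subseteq\mathcal J(S)$ is a foundation set for $X\in\mathcal J(S)$ if $X_i\subseteq X$ for all $i$ and every nonempty $Z\in\mathcal J(S)$ with $Z\subseteq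 X$ meets some $X_i$. $S$ is strongly C$^*$-regular on the boundary if, whenever $h_1,\dots,h_n\in I_\ell(S)$ and $X,X_1,\dots,X_m\in\mathcal J(S)$ ($m\ge 0$, $X_i\subseteq X$) satisfy $\emptyset\ne X\setminus\bigcup_iX_i\subseteq\bigcup_{k=1}^n\{s\in S: h_ks=s\}$, there are $Y_1,\dots,Y_l\in\mathcal J(S)$ ($l\ge0$) and indices $1\le k_j\le n$ with $h_{k_j}p_{Y_j}=p_{Y_j}$ for all $j$ and such that $\{X_1,\dots,X_m,Y_1,\dots,Y_l\}$ is a foundation set for $X$. Characters are nonzero semigroup homomorphisms $\chi:\mathcal J(S)\to\{0,1\}$, with the topology of pointwise convergence. $\chi_s(X)=1$ iff $s\in X$. $\Omega(S)=\overline{\{\chi_s:s\in S\}}$. $\mathcal G_P(S)$ is the set of classes $[g,\chi]$ of pairs $(g,\chi)\in I_\ell(S)\times\Omega(S)$ with $\chi(\operatorname{dom}g)=1$, where $(g_1,\chi_1)\sim(g_2,\chi_2)$ iff $\chi_1=\chi_2$ and $g_1|_A=g_2|_A$ for some $A\in\mathcal J(S)$ with $\chi_1(A)=1$. Product: $[g,\chi][h,\psi]=[gh,\psi]$ if $\chi=\psi(h^{-1}(\cdot))$; source $\chi$, range $\chi(g^{-1}(\cdot))$; unit space $\Omega(S)$ via $\chi\mapsto[p_S,\chi]$; a basis of topology consists of the sets $D(g,U)=\{[g,\chi]:\chi\in U\}$, $U\subseteq\{\chi\in\Omega(S):\chi(\operatorname{dom}g)=1\}$ open. This is a locally compact, possibly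 non-Hausdorff, étale groupoid. A bisection is a subset on which source and range maps are injective; $\mathcal G_x^x$ is the isotropy group at $x$. A filter on $\mathcal J(S)$ is a nonempty family of nonempty members of $\mathcal J(S)$ closed under finite intersections and upward inclusion; $\Omega_{\max}(S)\subseteq\Omega(S)$ is the set of characters $\chi$ such that $\chi^{-1}(1)$ is a maximal filter; $\partial\Omega(S)=\overline{\Omega_{\max}(S)}$. *)

theory Defs
  imports "HOL-Algebra.Group" "HOL-Analysis.Function_Topology"
begin

locale left_cancellative_monoid = monoid S for S (structure) +
  assumes left_cancellative:
    "\<lbrakk>s \<in> carrier S; t \<in> carrier S; t' \<in> carrier S; s \<otimes> t = s \<otimes> t'\<rbrakk> \<Longrightarrow> t = t'"


section \<open>The left inverse hull and the constructible right ideals\<close>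

text \<open>Partial maps on the carrier are maps of type \<open>'a \<rightharpoonup> 'a\<close>; they compose by \<open>\<circ>\<^sub>m\<close>.\<close>

definition left_translation :: "('a, 'b) monoid_scheme \<Rightarrow> 'a \<Rightarrow> ('a \<rightharpoonup> 'a)" where
  "left_translation S s = (\<lambda>t. Some (s \<otimes>\<^bsub>S\<^esub> t)) |` carrier S"

text \<open>The inverse of an injective partial map (a junk value if the map is not injective).\<close>

definition partial_inverse :: "('a \<rightharpoonup> 'a) \<Rightarrow> ('a \<rightharpoonup> 'a)" where
  "partial_inverse f = (\<lambda>y. if y \<in> ran f then Some (THE x. f x = Some y) else None)"

definition partial_id :: "'a set \<Rightarrow> ('a \<rightharpoonup> 'a)" where
  "partial_id X = Some |` X"

text \<open>
  \<open>I\<^sub>\<ell>(S)\<close>. The empty map belongs to it only if it arises as a composition; accordingly the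
  empty set need not be a constructible ideal.
\<close>

inductive_set left_inverse_hull :: "('a, 'b) monoid_scheme \<Rightarrow> ('a \<rightharpoonup> 'a) set"
  for S :: "('a, 'b) monoid_scheme" where
  translation: "s \<in> carrier S \<Longrightarrow> left_translation S s \<in> left_inverse_hull S"
| inverse: "g \<in> left_inverse_hull S \<Longrightarrow> partial_inverse g \<in> left_inverse_hull S"
| compose: "\<lbrakk>g \<in> left_inverse_hull S; h \<in> left_inverse_hull S\<rbrakk> \<Longrightarrow> g \<circ>\<^sub>m h \<in> left_inverse_hull S"

definition constructible_ideals :: "('a, 'b) monoid_scheme \<Rightarrow> 'a set set" where
  "constructible_ideals S = dom ` left_inverse_hull S"


section \<open>Strong C*-regularity on the boundary\<close>

definition foundation_set :: "('a, 'b) monoid_scheme \<Rightarrow> 'a set set \<Rightarrow> 'a set \<Rightarrow> bool" where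
  "foundation_set S \<F> X \<longleftrightarrow>
     finite \<F> \<and> \<F> \<subseteq> constructible_ideals S \<and> (\<forall>A\<in>\<F>. A \<subseteq> X) \<and>
     (\<forall>Z\<in>constructible_ideals S. Z \<noteq> {} \<and> Z \<subseteq> X \<longrightarrow> (\<exists>A\<in>\<F>. Z \<inter> A \<noteq> {}))"

definition strongly_regular_on_boundary :: "('a, 'b) monoid_scheme \<Rightarrow> bool" where
  "strongly_regular_on_boundary S \<longleftrightarrow>
     (\<forall>H X \<X>. finite H \<and> H \<subseteq> left_inverse_hull S \<and>
        X \<in> constructible_ideals S \<and>
        finite \<X> \<and> \<X> \<subseteq> constructible_ideals S \<and> (\<forall>A\<in>\<X>. A \<subseteq> X) \<and>
        X - \<Union>\<X> \<noteq> {} \<and> X - \<Union>\<X> \<subseteq> (\<Union>h\<in>H. {s \<in> carrier S. h s = Some s})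
      \<longrightarrow> (\<exists>\<Y>. finite \<Y> \<and> \<Y> \<subseteq> constructible_ideals S \<and>
            (\<forall>Y\<in>\<Y>. \<exists>h\<in>H. h \<circ>\<^sub>m partial_id Y = partial_id Y) \<and>
            foundation_set S (\<X> \<union> \<Y>) X))"


section \<open>Characters\<close>

text \<open>
  Characters are extensional functions on the constructible ideals, so that their topology is
  induced by the library's product topology.
\<close>

definition characters :: "('a, 'b) monoid_scheme \<Rightarrow> ('a set \<Rightarrow> nat) set" where
  "characters S =
     {\<chi> \<in> constructible_ideals S \<rightarrow>\<^sub>E {0, 1}.
        (\<exists>X\<in>constructible_ideals S. \<chi> X \<noteq> 0) \<and>
        (\<forall>X\<in>constructible_ideals S. \<forall>Y\<in>constructible_ideals S. \<chi> (X \<inter> Y) = \<chi> X * \<chi> Y)}"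

definition character_topology :: "('a, 'b) monoid_scheme \<Rightarrow> ('a set \<Rightarrow> nat) topology" where
  "character_topology S =
     subtopology (product_topology (\<lambda>_. discrete_topology {0, 1}) (constructible_ideals S))
       (characters S)"

definition point_character :: "('a, 'b) monoid_scheme \<Rightarrow> 'a \<Rightarrow> ('a set \<Rightarrow> nat)" where
  "point_character S s = (\<lambda>X\<in>constructible_ideals S. if s \<in> X then 1 else 0)"

abbreviation point_characters :: "('a, 'b) monoid_scheme \<Rightarrow> ('a set \<Rightarrow> nat) set" where
  "point_characters S \<equiv> point_character S ` carrier S"

definition spectrum :: "('a, 'b) monoid_scheme \<Rightarrow> ('a set \<Rightarrow> nat) set" where
  "spectrum S = character_topology S closure_of point_characters S"

definition spectrum_topology :: "('a, 'b) monoid_scheme \<Rightarrow> ('a set \<Rightarrow> nat) topology" where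
  "spectrum_topology S = subtopology (character_topology S) (spectrum S)"

definition ideal_filter :: "('a, 'b) monoid_scheme \<Rightarrow> 'a set set \<Rightarrow> bool" where
  "ideal_filter S F \<longleftrightarrow>
     F \<noteq> {} \<and> F \<subseteq> constructible_ideals S \<and> {} \<notin> F \<and>
     (\<forall>A\<in>F. \<forall>B\<in>F. A \<inter> B \<in> F) \<and>
     (\<forall>A\<in>F. \<forall>B\<in>constructible_ideals S. A \<subseteq> B \<longrightarrow> B \<in> F)"

definition maximal_ideal_filter :: "('a, 'b) monoid_scheme \<Rightarrow> 'a set set \<Rightarrow> bool" where
  "maximal_ideal_filter S F \<longleftrightarrow>
     ideal_filter S F \<and> (\<forall>F'. ideal_filter S F' \<and> F \<subseteq> F' \<longrightarrow> F' = F)"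

definition max_spectrum :: "('a, 'b) monoid_scheme \<Rightarrow> ('a set \<Rightarrow> nat) set" where
  "max_spectrum S =
     {\<chi> \<in> spectrum S. maximal_ideal_filter S {X \<in> constructible_ideals S. \<chi> X = 1}}"

definition boundary_spectrum :: "('a, 'b) monoid_scheme \<Rightarrow> ('a set \<Rightarrow> nat) set" where
  "boundary_spectrum S = spectrum_topology S closure_of max_spectrum S"


section \<open>The groupoid of germs\<close>

text \<open>
  Groupoid elements are equivalence classes of pairs \<open>(g, \<chi>)\<close>. A unit is identified with a
  character through \<open>gpd_unit\<close>; source and range are taken to be characters, and the unit space
  carries the topology \<open>spectrum_topology\<close>.
\<close>

type_synonym 'a germ = "(('a \<rightharpoonup> 'a) \<times> ('a set \<Rightarrow> nat)) set"

definition germ_pairs :: "('a, 'b) monoid_scheme \<Rightarrow> (('a \<rightharpoonup> 'a) \<times> ('a set \<Rightarrow> nat)) set" where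
  "germ_pairs S = {(g, \<chi>). g \<in> left_inverse_hull S \<and> \<chi> \<in> spectrum S \<and> \<chi> (dom g) = 1}"

definition germ_rel ::
  "('a, 'b) monoid_scheme \<Rightarrow> ((('a \<rightharpoonup> 'a) \<times> ('a set \<Rightarrow> nat)) \<times> (('a \<rightharpoonup> 'a) \<times> ('a set \<Rightarrow> nat))) set"
  where
  "germ_rel S =
     {((g\<^sub>1, \<chi>\<^sub>1), (g\<^sub>2, \<chi>\<^sub>2)). (g\<^sub>1, \<chi>\<^sub>1) \<in> germ_pairs S \<and> (g\<^sub>2, \<chi>\<^sub>2) \<in> germ_pairs S \<and>
        \<chi>\<^sub>1 = \<chi>\<^sub>2 \<and> (\<exists>A\<in>constructible_ideals S. \<chi>\<^sub>1 A = 1 \<and> g\<^sub>1 |` A = g\<^sub>2 |` A)}"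

definition germ :: "('a, 'b) monoid_scheme \<Rightarrow> ('a \<rightharpoonup> 'a) \<Rightarrow> ('a set \<Rightarrow> nat) \<Rightarrow> 'a germ" where
  "germ S g \<chi> = germ_rel S `` {(g, \<chi>)}"

definition gpd :: "('a, 'b) monoid_scheme \<Rightarrow> 'a germ set" where
  "gpd S = germ_pairs S // germ_rel S"

text \<open>The character \<open>X \<mapsto> \<chi> (g\<^sup>-\<^sup>1(X))\<close>, with the preimage taken under the partial map \<open>g\<close>.\<close>

definition push_character ::
  "('a, 'b) monoid_scheme \<Rightarrow> ('a \<rightharpoonup> 'a) \<Rightarrow> ('a set \<Rightarrow> nat) \<Rightarrow> ('a set \<Rightarrow> nat)" where
  "push_character S g \<chi> = (\<lambda>X\<in>constructible_ideals S. \<chi> (g -` (Some ` X)))"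

definition gpd_source :: "'a germ \<Rightarrow> ('a set \<Rightarrow> nat)" where
  "gpd_source \<gamma> = (THE \<chi>. \<exists>g. (g, \<chi>) \<in> \<gamma>)"

definition gpd_range :: "('a, 'b) monoid_scheme \<Rightarrow> 'a germ \<Rightarrow> ('a set \<Rightarrow> nat)" where
  "gpd_range S \<gamma> = (THE \<psi>. \<exists>g \<chi>. (g, \<chi>) \<in> \<gamma> \<and> \<psi> = push_character S g \<chi>)"

text \<open>
  Meaningful for composable pairs only. The product is recorded to complete the groupoid structure;
  the condition below only involves source, range, units and topology.
\<close>

definition gpd_mult :: "('a, 'b) monoid_scheme \<Rightarrow> 'a germ \<Rightarrow> 'a germ \<Rightarrow> 'a germ" where
  "gpd_mult S \<gamma> \<delta> =
     (THE \<tau>. \<exists>g h \<psi>. (g, push_character S h \<psi>) \<in> \<gamma> \<and> (h, \<psi>) \<in> \<delta> \<and> \<tau> = germ S (g \<circ>\<^sub>m h) \<psi>)"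

definition gpd_unit :: "('a, 'b) monoid_scheme \<Rightarrow> ('a set \<Rightarrow> nat) \<Rightarrow> 'a germ" where
  "gpd_unit S \<chi> = germ S (partial_id (carrier S)) \<chi>"

definition gpd_topology :: "('a, 'b) monoid_scheme \<Rightarrow> 'a germ topology" where
  "gpd_topology S = topology_generated_by
     {germ S g ` U | g U. g \<in> left_inverse_hull S \<and> openin (spectrum_topology S) U \<and>
        U \<subseteq> {\<chi> \<in> spectrum S. \<chi> (dom g) = 1}}"

definition bisection :: "('a, 'b) monoid_scheme \<Rightarrow> 'a germ set \<Rightarrow> bool" where
  "bisection S B \<longleftrightarrow> B \<subseteq> gpd S \<and> inj_on gpd_source B \<and> inj_on (gpd_range S) B"

definition isotropy :: "('a, 'b) monoid_scheme \<Rightarrow> ('a set \<Rightarrow> nat) \<Rightarrow> 'a germ set" where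
  "isotropy S x = {\<gamma> \<in> gpd S. gpd_source \<gamma> = x \<and> gpd_range S \<gamma> = x}"

text \<open>Condition (C) at the unit \<open>x\<close>, with \<open>Y\<close> the set of the characters \<open>\<chi>\<^sub>s\<close>.\<close>

definition condition_C :: "('a, 'b) monoid_scheme \<Rightarrow> ('a set \<Rightarrow> nat) \<Rightarrow> bool" where
  "condition_C S x \<longleftrightarrow>
     (\<exists>(n::nat) g B U. n \<ge> 1 \<and>
        (\<forall>k\<in>{1..n}. g k \<in> isotropy S x - {gpd_unit S x} \<and>
           openin (gpd_topology S) (B k) \<and> bisection S (B k) \<and> g k \<in> B k) \<and>
        U \<subseteq> spectrum S \<and> (\<exists>V. openin (spectrum_topology S) V \<and> x \<in> V \<and> V \<subseteq> U) \<and>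
        gpd_unit S ` (point_characters S \<inter> U) \<subseteq> (\<Union>k\<in>{1..n}. B k))"

end

theory Submission
  imports Defs
begin

text \<open>
  Elements of the hull commute with right multiplication, so \<open>h s = s\<close> forces \<open>h\<close> to fix the whole
  ideal \<open>sS\<close>. Hence a point character \<open>\<chi>\<^sub>s\<close>, viewed as a unit, lies in the basic bisection of \<open>h\<close>
  exactly if \<open>h s = s\<close>, and the covering in Condition (C) near \<open>\<chi>\<close> says that some \<open>X - \<Union>\<X>\<close>
  with \<open>\<chi> X = 1\<close> and \<open>\<chi> = 0\<close> on \<open>\<X>\<close> is covered by the fixed point sets of finitely many \<open>h\<close>.
  Boundary characters with \<open>\<chi> X = 1\<close> meet every foundation set of \<open>X\<close>, so under regularity one of
  the isotropy germs is a unit. Conversely, if regularity fails, compactness gives a boundary character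
  that vanishes on \<open>\<X>\<close> and on all ideals fixed pointwise by one of the \<open>h\<close>; it is not a point
  character, and the germs of those \<open>h\<close> whose fixed points accumulate at it witness (C).
\<close>

section \<open>Partial maps\<close>

text \<open>Only values \<open>Some y\<close> are compared: \<open>inj\<close> would also forbid two
  points outside the domain, where the value is \<open>None\<close>.\<close>

definition map_inj :: "('a \<rightharpoonup> 'b) \<Rightarrow> bool" where
  "map_inj f \<longleftrightarrow> (\<forall>x x' y. f x = Some y \<longrightarrow> f x' = Some y \<longrightarrow> x = x')"

lemma partial_inverse_iff:
  assumes "map_inj f"
  shows "partial_inverse f y = Some x \<longleftrightarrow> f x = Some y"
proof (cases "y \<in> ran f")
  case True
  then obtain x' where x': "f x' = Some y"
    by (auto simp: ran_def)
  then have "(THE x. f x = Some y) = x'"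
    using assms by (intro the_equality) (auto simp: map_inj_def)
  then show ?thesis
    using True x' assms by (auto simp: partial_inverse_def map_inj_def)
qed (auto simp: partial_inverse_def ran_def)

lemma map_inj_partial_inverse: "map_inj f \<Longrightarrow> map_inj (partial_inverse f)"
  using partial_inverse_iff[of f] by (simp add: map_inj_def)

lemma dom_partial_inverse: "dom (partial_inverse f) = ran f"
  by (auto simp: partial_inverse_def dom_def)

text \<open>This puts the identity on the domain of each hull element into the hull, so
  constructible ideals are represented by idempotents.\<close>

lemma partial_inverse_comp:
  assumes "map_inj f"
  shows "partial_inverse f \<circ>\<^sub>m f = partial_id (dom f)"
proof
  fix x
  show "(partial_inverse f \<circ>\<^sub>m f) x = partial_id (dom f) x"
    using partial_inverse_iff[OF assms]
    by (cases "f x") (auto simp: map_comp_def partial_id_def restrict_map_def)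
qed

text \<open>A preimage is thereby the domain of a composition, which is how preimages of
  constructible ideals become constructible.\<close>

lemma dom_partial_id_comp: "dom (partial_id X \<circ>\<^sub>m g) = g -` (Some ` X)"
  by (auto simp: map_comp_def partial_id_def restrict_map_def split: option.splits if_splits)

lemma comp_partial_id_eq_iff:
  "h \<circ>\<^sub>m partial_id Y = partial_id Y \<longleftrightarrow> (\<forall>y\<in>Y. h y = Some y)"
  by (auto simp: fun_eq_iff map_comp_def partial_id_def restrict_map_def)

lemma restrict_map_eq_iff: "g |` A = h |` A \<longleftrightarrow> (\<forall>x\<in>A. g x = h x)"
  by (auto simp: fun_eq_iff restrict_map_def)

context left_cancellative_monoid
begin

section \<open>The left inverse hull\<close>

text \<open>One induction for all four properties, because they depend on each other: the domain of
  an inverse is a range, and the inverse is controlled only through injectivity. For translations,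
  injectivity is left cancellation and equivariance under right multiplication is
  associativity.\<close>

lemma hull_props:
  assumes "g \<in> left_inverse_hull S"
  shows "map_inj g \<and> dom g \<subseteq> carrier S \<and> ran g \<subseteq> carrier S \<and>
    (\<forall>s t r. g s = Some t \<longrightarrow> r \<in> carrier S \<longrightarrow> g (s \<otimes> r) = Some (t \<otimes> r))"
  using assms
proof induction
  case (translation s)
  then show ?case
    using left_cancellative[of s]
    by (auto simp: left_translation_def map_inj_def restrict_map_def ran_def m_assoc split: if_splits)
next
  case (inverse g)
  then have "map_inj g" by blast
  note iff = partial_inverse_iff[OF this]
  have "ran (partial_inverse g) \<subseteq> carrier S"
    using inverse by (auto simp: ran_def iff)
  then show ?case
    using inverse map_inj_partial_inverse[of g] by (simp add: dom_partial_inverse iff)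
next
  case (compose g h)
  then have g: "map_inj g" and h: "map_inj h" by auto
  have iff: "(g \<circ>\<^sub>m h) x = Some z \<longleftrightarrow> (\<exists>y. h x = Some y \<and> g y = Some z)" for x z
    by (auto simp: map_comp_def split: option.splits)
  have "map_inj (g \<circ>\<^sub>m h)"
    using g h unfolding map_inj_def iff by metis
  moreover have "dom (g \<circ>\<^sub>m h) \<subseteq> carrier S" "ran (g \<circ>\<^sub>m h) \<subseteq> carrier S"
    using compose ranI[of g] by (auto simp: ran_def map_comp_def split: option.splits)
  ultimately show ?case
    using compose unfolding iff by blast
qed

lemmas hull_inj = hull_props[THEN conjunct1]
lemmas hull_dom = hull_props[THEN conjunct2, THEN conjunct1]

lemma hull_equivariant:
  "\<lbrakk>g \<in> left_inverse_hull S; g s = Some t; r \<in> carrier S\<rbrakk> \<Longrightarrow> g (s \<otimes> r) = Some (t \<otimes> r)"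
  using hull_props by blast

lemma partial_id_carrier_hull: "partial_id (carrier S) \<in> left_inverse_hull S"
proof -
  have "partial_id (carrier S) = left_translation S \<one>"
    by (auto simp: partial_id_def left_translation_def restrict_map_def)
  then show ?thesis
    by (simp add: left_inverse_hull.translation)
qed

section \<open>Closure properties of the constructible ideals\<close>

lemma dom_constructible: "g \<in> left_inverse_hull S \<Longrightarrow> dom g \<in> constructible_ideals S"
  by (simp add: constructible_ideals_def)

lemma carrier_constructible: "carrier S \<in> constructible_ideals S"
  using dom_constructible[OF partial_id_carrier_hull] by (simp add: partial_id_def)

lemma constructible_subset: "X \<in> constructible_ideals S \<Longrightarrow> X \<subseteq> carrier S"
  using hull_dom by (auto simp: constructible_ideals_def)

lemma partial_id_hull: "X \<in> constructible_ideals S \<Longrightarrow> partial_id X \<in> left_inverse_hull S"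
  unfolding constructible_ideals_def
  using partial_inverse_comp hull_inj left_inverse_hull.inverse left_inverse_hull.compose
  by (metis imageE)

lemma preimage_constructible:
  "\<lbrakk>g \<in> left_inverse_hull S; X \<in> constructible_ideals S\<rbrakk>
    \<Longrightarrow> g -` (Some ` X) \<in> constructible_ideals S"
  by (metis dom_partial_id_comp dom_constructible partial_id_hull left_inverse_hull.compose)

lemma Int_constructible:
  assumes "X \<in> constructible_ideals S" "Y \<in> constructible_ideals S"
  shows "X \<inter> Y \<in> constructible_ideals S"
proof -
  have "partial_id Y -` (Some ` X) = X \<inter> Y"
    by (auto simp: partial_id_def restrict_map_def split: if_splits)
  then show ?thesis
    using preimage_constructible[OF partial_id_hull] assms by metis
qed

text \<open>The factor \<open>carrier S\<close> gives the empty family the right value, since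
  \<open>\<Inter>{}\<close> is the whole type.\<close>

lemma carrier_Int_Inter_constructible:
  "\<lbrakk>finite F; F \<subseteq> constructible_ideals S\<rbrakk> \<Longrightarrow> carrier S \<inter> \<Inter>F \<in> constructible_ideals S"
proof (induction F rule: finite_induct)
  case (insert A F)
  then have "A \<inter> (carrier S \<inter> \<Inter>F) \<in> constructible_ideals S"
    using Int_constructible by simp
  moreover have "A \<inter> (carrier S \<inter> \<Inter>F) = carrier S \<inter> \<Inter>(insert A F)"
    by auto
  ultimately show ?case
    by metis
qed (simp add: carrier_constructible)

text \<open>The ideal \<open>sS\<close> is the range of translation by \<open>s\<close>, hence the
  domain of its inverse.\<close>

lemma principal_constructible:
  assumes "s \<in> carrier S"
  shows "(\<otimes>) s ` carrier S \<in> constructible_ideals S"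
proof -
  have "ran (left_translation S s) = (\<otimes>) s ` carrier S"
    by (auto simp: left_translation_def ran_def restrict_map_def split: if_splits)
  then show ?thesis
    using assms dom_constructible dom_partial_inverse left_inverse_hull.intros by metis
qed

lemma fixed_principal:
  assumes "h \<in> left_inverse_hull S" "h s = Some s" "t \<in> (\<otimes>) s ` carrier S"
  shows "h t = Some t"
  using assms hull_equivariant by auto

lemma self_mem_principal: "s \<in> carrier S \<Longrightarrow> s \<in> (\<otimes>) s ` carrier S"
  by (metis image_eqI one_closed r_one)

section \<open>Characters and their topology\<close>

lemma characters_subset: "characters S \<subseteq> constructible_ideals S \<rightarrow>\<^sub>E {0, 1}"
  by (auto simp: characters_def)

lemma character_range:
  "\<lbrakk>\<chi> \<in> characters S; A \<in> constructible_ideals S\<rbrakk> \<Longrightarrow> \<chi> A = 0 \<or> \<chi> A = 1"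
  by (auto simp: characters_def)

lemma character_Int:
  "\<lbrakk>\<chi> \<in> characters S; A \<in> constructible_ideals S; B \<in> constructible_ideals S\<rbrakk>
    \<Longrightarrow> \<chi> (A \<inter> B) = \<chi> A * \<chi> B"
  by (auto simp: characters_def)

text \<open>Every ideal X equals X \<inter> S, so a nonzero value \<open>\<chi> X\<close> can be
  cancelled from \<open>\<chi> X = \<chi> X * \<chi> (carrier S)\<close>.\<close>

lemma character_carrier:
  assumes "\<chi> \<in> characters S"
  shows "\<chi> (carrier S) = 1"
proof -
  obtain X where X: "X \<in> constructible_ideals S" "\<chi> X \<noteq> 0"
    using assms by (auto simp: characters_def)
  then have "\<chi> X = \<chi> X * \<chi> (carrier S)"
    using character_Int[OF assms X(1) carrier_constructible] constructible_subset
    by (simp add: Int_absorb2)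
  then show ?thesis
    using X by simp
qed

lemma character_carrier_Int_Inter:
  assumes "\<chi> \<in> characters S"
  shows "\<lbrakk>finite F; F \<subseteq> constructible_ideals S\<rbrakk>
    \<Longrightarrow> \<chi> (carrier S \<inter> \<Inter>F) = 1 \<longleftrightarrow> (\<forall>A\<in>F. \<chi> A = 1)"
proof (induction F rule: finite_induct)
  case (insert A F)
  have "carrier S \<inter> \<Inter>(insert A F) = A \<inter> (carrier S \<inter> \<Inter>F)"
    by auto
  then show ?case
    using insert carrier_Int_Inter_constructible character_Int[OF assms, of A "carrier S \<inter> \<Inter>F"]
    by simp
qed (simp add: character_carrier[OF assms])

lemma point_character_apply [simp]:
  "A \<in> constructible_ideals S \<Longrightarrow> point_character S s A = (if s \<in> A then 1 else 0)"
  by (simp add: point_character_def)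

lemma point_character_in: "s \<in> carrier S \<Longrightarrow> point_character S s \<in> characters S"
  using carrier_constructible Int_constructible
  by (auto simp: characters_def point_character_def)

lemma topspace_character_topology: "topspace (character_topology S) = characters S"
  by (auto simp: character_topology_def characters_def PiE_def Pi_def)

section \<open>Cylinder neighbourhoods and closures as finite approximation\<close>

lemma openin_product_cylinder:
  assumes "finite F" "F \<subseteq> I"
  shows "openin (product_topology (\<lambda>_. discrete_topology {0, 1::nat}) I)
    {f \<in> I \<rightarrow>\<^sub>E {0, 1}. \<forall>A\<in>F. f A = c A}"
proof -
  \<comment> \<open>Intersecting with \<open>{0, 1}\<close> keeps each factor open in the discrete
    space; if \<open>c A\<close> is neither 0 nor 1, both sides are empty as soon as A \<in>
    F.\<close>
  have eq: "{f \<in> I \<rightarrow>\<^sub>E {0, 1}. \<forall>A\<in>F. f A = c A}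
      = (\<Pi>\<^sub>E A\<in>I. if A \<in> F then {0, 1} \<inter> {c A} else {0, 1::nat})" (is "?L = ?R")
  proof (intro Set.set_eqI iffI)
    fix f assume "f \<in> ?L"
    then show "f \<in> ?R"
      by (auto simp: PiE_iff)
  next
    fix f assume f: "f \<in> ?R"
    have "f A \<in> {0, 1} \<and> (A \<in> F \<longrightarrow> f A = c A)" if "A \<in> I" for A
      using PiE_mem[OF f that] by (cases "A \<in> F") auto
    then show "f \<in> ?L"
      using f \<open>F \<subseteq> I\<close> by (auto simp: PiE_iff)
  qed
  show ?thesis
    unfolding eq
    by (rule product_topology_basis)
       (use assms in \<open>auto intro!: finite_subset[OF _ \<open>finite F\<close>]\<close>)
qed

text \<open>A basic open box restricts only finitely many coordinates; these form \<open>F\<close>,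
  and agreeing with \<open>f\<close> there keeps a point in the box.\<close>

lemma product_neighbourhood_cylinder:
  assumes "openin (product_topology (\<lambda>_. discrete_topology {0, 1::nat}) I) V" "f \<in> V"
  obtains F where "finite F" "F \<subseteq> I"
    "\<And>f'. \<lbrakk>f' \<in> I \<rightarrow>\<^sub>E {0, 1}; \<forall>A\<in>F. f' A = f A\<rbrakk> \<Longrightarrow> f' \<in> V"
proof -
  obtain W where W: "finite {i \<in> I. W i \<noteq> {0, 1::nat}}" "f \<in> Pi\<^sub>E I W" "Pi\<^sub>E I W \<subseteq> V"
    using assms by (auto simp: openin_product_topology_alt)
  have "f' \<in> V" if "f' \<in> I \<rightarrow>\<^sub>E {0, 1}" "\<forall>A\<in>{i \<in> I. W i \<noteq> {0, 1}}. f' A = f A" for f'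
  proof -
    have "f' A \<in> W A" if "A \<in> I" for A
      using \<open>\<forall>A\<in>_. f' A = f A\<close> \<open>f' \<in> _\<close> W(2) that by (cases "W A = {0, 1}") (auto simp: PiE_iff)
    then have "f' \<in> Pi\<^sub>E I W"
      using \<open>f' \<in> _\<close> by (auto simp: PiE_iff)
    then show ?thesis
      using W(3) by blast
  qed
  then show thesis
    using that W(1) by auto
qed

lemma openin_character_cylinder:
  assumes "finite F" "F \<subseteq> constructible_ideals S"
  shows "openin (character_topology S) {\<psi> \<in> characters S. \<forall>A\<in>F. \<psi> A = c A}"
proof -
  have "{\<psi> \<in> characters S. \<forall>A\<in>F. \<psi> A = c A}
      = {f \<in> constructible_ideals S \<rightarrow>\<^sub>E {0, 1}. \<forall>A\<in>F. f A = c A} \<inter> characters S"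
    using characters_subset by blast
  then show ?thesis
    using openin_subtopology_Int[OF openin_product_cylinder[OF assms], of "characters S" c]
    by (simp only: character_topology_def)
qed

lemma character_neighbourhood_cylinder:
  assumes "openin (character_topology S) V" "\<chi> \<in> V"
  obtains F where "finite F" "F \<subseteq> constructible_ideals S"
    "\<And>\<psi>. \<lbrakk>\<psi> \<in> characters S; \<forall>A\<in>F. \<psi> A = \<chi> A\<rbrakk> \<Longrightarrow> \<psi> \<in> V"
proof -
  obtain W where W: "openin (product_topology (\<lambda>_. discrete_topology {0, 1}) (constructible_ideals S)) W"
    "V = W \<inter> characters S"
    using assms by (auto simp: character_topology_def openin_subtopology)
  obtain F where "finite F" "F \<subseteq> constructible_ideals S"
    "\<And>f. \<lbrakk>f \<in> constructible_ideals S \<rightarrow>\<^sub>E {0, 1}; \<forall>A\<in>F. f A = \<chi> A\<rbrakk> \<Longrightarrow> f \<in> W"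
    using product_neighbourhood_cylinder[OF W(1), of \<chi>] W(2) assms(2) by blast
  then show thesis
    using that W(2) by (auto simp: characters_def)
qed

text \<open>Cylinders form neighbourhood bases, so lying in a closure means being matched on every
  finite set of ideals. Later arguments about spectrum and boundary use this form.\<close>

lemma character_closure_iff:
  assumes "T \<subseteq> characters S"
  shows "\<chi> \<in> character_topology S closure_of T \<longleftrightarrow> \<chi> \<in> characters S \<and>
    (\<forall>F. finite F \<and> F \<subseteq> constructible_ideals S \<longrightarrow> (\<exists>\<psi>\<in>T. \<forall>A\<in>F. \<psi> A = \<chi> A))"
    (is "?L \<longleftrightarrow> ?R")
proof
  assume L: ?L
  have "\<exists>\<psi>\<in>T. \<forall>A\<in>F. \<psi> A = \<chi> A" if "finite F" "F \<subseteq> constructible_ideals S" for F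
    using openin_character_cylinder[OF that, of \<chi>] L
    by (auto simp: in_closure_of topspace_character_topology dest: spec[of _ "{\<psi> \<in> characters S. \<forall>A\<in>F. \<psi> A = \<chi> A}"])
  then show ?R
    using L by (auto simp: in_closure_of topspace_character_topology)
next
  assume R: ?R
  show ?L
    unfolding in_closure_of topspace_character_topology
  proof (intro conjI allI impI)
    fix V assume V: "\<chi> \<in> V \<and> openin (character_topology S) V"
    obtain F where F: "finite F" "F \<subseteq> constructible_ideals S"
      "\<And>\<psi>. \<lbrakk>\<psi> \<in> characters S; \<forall>A\<in>F. \<psi> A = \<chi> A\<rbrakk> \<Longrightarrow> \<psi> \<in> V"
      using character_neighbourhood_cylinder[of V \<chi>] V by blast
    obtain \<psi> where "\<psi> \<in> T" "\<forall>A\<in>F. \<psi> A = \<chi> A"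
      using R F(1,2) by blast
    then show "\<exists>\<psi>. \<psi> \<in> T \<and> \<psi> \<in> V"
      using F(3) assms by blast
  qed (use R in blast)
qed

lemma spectrum_iff:
  "\<chi> \<in> spectrum S \<longleftrightarrow> \<chi> \<in> characters S \<and>
    (\<forall>F. finite F \<and> F \<subseteq> constructible_ideals S \<longrightarrow>
      (\<exists>s\<in>carrier S. \<forall>A\<in>F. point_character S s A = \<chi> A))"
  unfolding spectrum_def
  by (subst character_closure_iff) (auto simp: point_character_in)

lemma spectrum_subset: "spectrum S \<subseteq> characters S"
  by (auto simp: spectrum_iff)

lemma point_character_spectrum: "s \<in> carrier S \<Longrightarrow> point_character S s \<in> spectrum S"
  by (auto simp: spectrum_iff point_character_in)

lemma openin_spectrum_cylinder:
  assumes "finite F" "F \<subseteq> constructible_ideals S"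
  shows "openin (spectrum_topology S) {\<psi> \<in> spectrum S. \<forall>A\<in>F. \<psi> A = c A}"
proof -
  have "{\<psi> \<in> spectrum S. \<forall>A\<in>F. \<psi> A = c A} = {\<psi> \<in> characters S. \<forall>A\<in>F. \<psi> A = c A} \<inter> spectrum S"
    using spectrum_subset by auto
  then show ?thesis
    using openin_subtopology_Int[OF openin_character_cylinder[OF assms], of "spectrum S" c]
    by (simp only: spectrum_topology_def)
qed

lemma openin_spectrum_eval:
  "A \<in> constructible_ideals S \<Longrightarrow> openin (spectrum_topology S) {\<psi> \<in> spectrum S. \<psi> A = 1}"
  using openin_spectrum_cylinder[of "{A}" "\<lambda>_. 1"] by simp

lemma spectrum_neighbourhood_cylinder:
  assumes "openin (spectrum_topology S) V" "\<chi> \<in> V"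
  obtains F where "finite F" "F \<subseteq> constructible_ideals S"
    "\<And>\<psi>. \<lbrakk>\<psi> \<in> spectrum S; \<forall>A\<in>F. \<psi> A = \<chi> A\<rbrakk> \<Longrightarrow> \<psi> \<in> V"
proof -
  obtain W where W: "openin (character_topology S) W" "V = W \<inter> spectrum S"
    using assms by (auto simp: spectrum_topology_def openin_subtopology)
  obtain F where "finite F" "F \<subseteq> constructible_ideals S"
    "\<And>\<psi>. \<lbrakk>\<psi> \<in> characters S; \<forall>A\<in>F. \<psi> A = \<chi> A\<rbrakk> \<Longrightarrow> \<psi> \<in> W"
    using character_neighbourhood_cylinder[OF W(1), of \<chi>] W(2) assms(2) by blast
  then show thesis
    using that W(2) spectrum_subset by blast
qed

lemma boundary_iff:
  "\<chi> \<in> boundary_spectrum S \<longleftrightarrow> \<chi> \<in> spectrum S \<and>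
    (\<forall>F. finite F \<and> F \<subseteq> constructible_ideals S \<longrightarrow> (\<exists>\<psi>\<in>max_spectrum S. \<forall>A\<in>F. \<psi> A = \<chi> A))"
proof -
  have "max_spectrum S \<subseteq> spectrum S"
    by (auto simp: max_spectrum_def)
  \<comment> \<open>Closure in a subspace is the ambient closure cut down to the subspace.\<close>
  then have "boundary_spectrum S = spectrum S \<inter> character_topology S closure_of max_spectrum S"
    unfolding boundary_spectrum_def spectrum_topology_def
    by (metis closure_of_subtopology_subset closure_of_subtopology Int_absorb1)
  then show ?thesis
    using character_closure_iff[of "max_spectrum S" \<chi>] \<open>max_spectrum S \<subseteq> spectrum S\<close> spectrum_subset
    by blast
qed

text \<open>Compactness: for finite sets of ideals \<open>\<D>\<close>, the closures of the members
  of \<open>M\<close> vanishing on \<open>\<D>\<close> have the finite intersection property, and a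
  common point is the required limit. Closures are taken in the full product, which is compact by
  Tychonoff; that the limit is a character is shown afterwards.\<close>

lemma characters_limit:
  assumes "\<And>\<D>. \<lbrakk>finite \<D>; \<D> \<subseteq> \<Y>\<rbrakk> \<Longrightarrow> \<exists>\<psi>\<in>M. \<forall>A\<in>\<D>. \<psi> A = 0"
    and "M \<subseteq> characters S" "\<Y> \<subseteq> constructible_ideals S"
  obtains \<chi> where "\<chi> \<in> character_topology S closure_of M" "\<And>A. A \<in> \<Y> \<Longrightarrow> \<chi> A = 0"
proof -
  let ?J = "constructible_ideals S"
  let ?P = "product_topology (\<lambda>_. discrete_topology {0, 1::nat}) ?J"
  let ?M = "\<lambda>\<D>. {\<psi> \<in> M. \<forall>A\<in>\<D>. \<psi> A = 0}"
  let ?C = "(\<lambda>\<D>. ?P closure_of ?M \<D>) ` {\<D>. finite \<D> \<and> \<D> \<subseteq> \<Y>}"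
  have "compact_space ?P"
    by (simp add: compact_space_product_topology compact_space_discrete_topology)
  have M: "M \<subseteq> ?J \<rightarrow>\<^sub>E {0, 1}"
    using assms(2) characters_subset by (rule order_trans)
  have "\<Inter>\<F> \<noteq> {}" if "finite \<F>" "\<F> \<subseteq> ?C" for \<F>
  proof -
    obtain \<U> where \<U>: "finite \<U>" "\<U> \<subseteq> {\<D>. finite \<D> \<and> \<D> \<subseteq> \<Y>}"
      "\<F> = (\<lambda>\<D>. ?P closure_of ?M \<D>) ` \<U>"
      using finite_subset_image[OF \<open>finite \<F>\<close> \<open>\<F> \<subseteq> ?C\<close>] by blast
    \<comment> \<open>Finitely many vanishing conditions combine into one, on the union of the
      finite sets involved.\<close>
    then have "finite (\<Union>\<U>)" "\<Union>\<U> \<subseteq> \<Y>"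
      by auto
    then obtain \<psi> where \<psi>: "\<psi> \<in> M" "\<forall>A\<in>\<Union>\<U>. \<psi> A = 0"
      using assms(1) by blast
    have "\<psi> \<in> ?P closure_of ?M \<D>" if "\<D> \<in> \<U>" for \<D>
    proof -
      have "?M \<D> \<subseteq> ?P closure_of ?M \<D>"
        using M by (intro closure_of_subset) fastforce
      then show ?thesis
        using \<psi> that by blast
    qed
    then show ?thesis
      using \<U>(3) by blast
  qed
  moreover have "\<forall>C\<in>?C. closedin ?P C"
    by (intro ballI) (erule imageE, simp)
  ultimately have "\<Inter>?C \<noteq> {}"
    using \<open>compact_space ?P\<close>[unfolded compact_space_fip, THEN spec, of ?C] by meson
  then obtain \<chi> where \<chi>: "\<chi> \<in> \<Inter>?C"
    by blast
  have approx: "\<exists>\<psi>\<in>M. (\<forall>A\<in>\<D>. \<psi> A = 0) \<and> (\<forall>A\<in>F. \<psi> A = \<chi> A)"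
    if "finite F" "F \<subseteq> ?J" "finite \<D>" "\<D> \<subseteq> \<Y>" for F \<D>
  proof -
    have "\<chi> \<in> ?P closure_of ?M \<D>"
      using \<chi> that by blast
    then have "\<chi> \<in> topspace ?P" and
      *: "\<forall>T. \<chi> \<in> T \<and> openin ?P T \<longrightarrow> (\<exists>y. y \<in> ?M \<D> \<and> y \<in> T)"
      unfolding in_closure_of by (rule conjunct1, rule conjunct2)
    then have "\<chi> \<in> {f \<in> ?J \<rightarrow>\<^sub>E {0, 1}. \<forall>A\<in>F. f A = \<chi> A}"
      by simp
    from *[rule_format, OF conjI, OF this openin_product_cylinder[OF that(1,2)]]
    obtain \<psi> where "\<psi> \<in> ?M \<D>" "\<psi> \<in> {f \<in> ?J \<rightarrow>\<^sub>E {0, 1}. \<forall>A\<in>F. f A = \<chi> A}"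
      by blast
    then show ?thesis
      by (intro bexI[of _ \<psi>]) simp_all
  qed
  \<comment> \<open>Each defining equation involves finitely many ideals and so passes to the limit;
    the value 1 at \<open>carrier S\<close>, shared by all characters, prevents the limit from being
    zero.\<close>
  have "\<chi> \<in> characters S"
  proof -
    have "\<chi> \<in> ?P closure_of ?M {}"
      using \<chi> by blast
    then have "\<chi> \<in> ?J \<rightarrow>\<^sub>E {0, 1}"
      by (auto simp: in_closure_of)
    moreover have "\<chi> (carrier S) = 1"
      using approx[of "{carrier S}" "{}"] carrier_constructible assms(2) character_carrier by force
    moreover have "\<chi> (A \<inter> B) = \<chi> A * \<chi> B" if "A \<in> ?J" "B \<in> ?J" for A B
    proof -
      have "finite {A, B, A \<inter> B}" "{A, B, A \<inter> B} \<subseteq> ?J"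
        using that Int_constructible[OF that] by auto
      then obtain \<psi> where "\<psi> \<in> M" "\<forall>C\<in>{A, B, A \<inter> B}. \<psi> C = \<chi> C"
        using approx[of "{A, B, A \<inter> B}" "{}"] by blast
      moreover have "\<psi> (A \<inter> B) = \<psi> A * \<psi> B"
        using \<open>\<psi> \<in> M\<close> assms(2) that by (intro character_Int) auto
      ultimately show ?thesis
        by (metis insertCI)
    qed
    ultimately show ?thesis
      using carrier_constructible unfolding characters_def
      by (smt (verit) mem_Collect_eq one_neq_zero)
  qed
  moreover have "\<exists>\<psi>\<in>M. \<forall>A\<in>F. \<psi> A = \<chi> A" if "finite F" "F \<subseteq> ?J" for F
    using approx[OF that, of "{}"] by auto
  ultimately have "\<chi> \<in> character_topology S closure_of M"
    unfolding character_closure_iff[OF assms(2)] by blast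
  moreover have "\<chi> A = 0" if "A \<in> \<Y>" for A
    using approx[of "{A}" "{A}"] that assms(3) by force
  ultimately show thesis
    using that by blast
qed

section \<open>Maximal filters\<close>

lemma ideal_filter_Int: "\<lbrakk>ideal_filter S F; A \<in> F; B \<in> F\<rbrakk> \<Longrightarrow> A \<inter> B \<in> F"
  by (simp add: ideal_filter_def)

lemma ideal_filter_mono:
  "\<lbrakk>ideal_filter S F; A \<in> F; B \<in> constructible_ideals S; A \<subseteq> B\<rbrakk> \<Longrightarrow> B \<in> F"
  by (simp add: ideal_filter_def)

lemma ideal_filter_nonempty: "\<lbrakk>ideal_filter S F; A \<in> F\<rbrakk> \<Longrightarrow> A \<noteq> {}"
  by (auto simp: ideal_filter_def)

lemma maximal_ideal_filter_imp_filter: "maximal_ideal_filter S F \<Longrightarrow> ideal_filter S F"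
  by (simp add: maximal_ideal_filter_def)

text \<open>Zorn's lemma, applied to the filters containing the principal filter of
  \<open>Z\<close>, which is proper because \<open>Z\<close> is nonempty.\<close>

lemma maximal_ideal_filter_exists:
  assumes "Z \<in> constructible_ideals S" "Z \<noteq> {}"
  obtains F where "maximal_ideal_filter S F" "Z \<in> F"
proof -
  let ?F0 = "{A \<in> constructible_ideals S. Z \<subseteq> A}"
  have F0: "ideal_filter S ?F0"
    using assms Int_constructible unfolding ideal_filter_def by blast
  let ?A = "{F. ideal_filter S F \<and> ?F0 \<subseteq> F}"
  have "\<exists>M\<in>?A. \<forall>F\<in>?A. M \<subseteq> F \<longrightarrow> F = M"
  proof (rule subset_Zorn_nonempty)
    show "?A \<noteq> {}"
      using F0 by blast
  next
    fix \<C> assume \<C>: "\<C> \<noteq> {}" "subset.chain ?A \<C>"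
    then have filter: "ideal_filter S F" if "F \<in> \<C>" for F
      using that by (auto simp: subset.chain_def)
    have "A \<inter> B \<in> \<Union>\<C>" if "A \<in> \<Union>\<C>" "B \<in> \<Union>\<C>" for A B
    proof -
      obtain F G where "F \<in> \<C>" "G \<in> \<C>" "A \<in> F" "B \<in> G"
        using \<open>A \<in> \<Union>\<C>\<close> \<open>B \<in> \<Union>\<C>\<close> by blast
      \<comment> \<open>In a chain the larger of the two filters contains both sets, hence their
        intersection.\<close>
      moreover have "F \<subseteq> G \<or> G \<subseteq> F"
        using \<C> calculation by (metis subset_chain_def)
      ultimately obtain K where "K \<in> \<C>" "A \<in> K" "B \<in> K"
        by blast
      then show ?thesis
        using ideal_filter_Int[OF filter] by blast
    qed
    moreover have "\<Union>\<C> \<noteq> {}" "\<Union>\<C> \<subseteq> constructible_ideals S" "{} \<notin> \<Union>\<C>"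
      "\<forall>A\<in>\<Union>\<C>. \<forall>B\<in>constructible_ideals S. A \<subseteq> B \<longrightarrow> B \<in> \<Union>\<C>"
      using filter \<C>(1) unfolding ideal_filter_def by blast+
    moreover have "?F0 \<subseteq> \<Union>\<C>"
      using \<C> by (fastforce simp: subset.chain_def)
    ultimately show "\<Union>\<C> \<in> ?A"
      unfolding ideal_filter_def by blast
  qed
  then obtain M where M: "M \<in> ?A" "\<forall>F\<in>?A. M \<subseteq> F \<longrightarrow> F = M"
    by (rule bexE)
  \<comment> \<open>A filter above \<open>M\<close> also contains the principal filter, so
    maximality within \<open>?A\<close> is maximality among all filters.\<close>
  have "maximal_ideal_filter S M"
    unfolding maximal_ideal_filter_def
  proof (intro conjI allI impI)
    fix F assume F: "ideal_filter S F \<and> M \<subseteq> F"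
    moreover have "?F0 \<subseteq> M"
      using M(1) by simp
    ultimately have "F \<in> ?A"
      by (metis (mono_tags, lifting) mem_Collect_eq order_trans)
    then show "F = M"
      using M(2) F by metis
  qed (use M(1) in simp)
  moreover have "Z \<in> M"
    using M(1) assms(1) by auto
  ultimately show thesis
    by (rule that)
qed

text \<open>Otherwise \<open>X\<close> meets every member of \<open>F\<close>; the traces on
  \<open>X\<close> then generate a proper filter containing both \<open>F\<close> and
  \<open>X\<close>, and maximality forces \<open>X\<close> into \<open>F\<close>.\<close>

lemma maximal_ideal_filter_disjoint:
  assumes "maximal_ideal_filter S F" "X \<in> constructible_ideals S" "X \<notin> F"
  obtains Z where "Z \<in> F" "Z \<inter> X = {}"
proof (rule ccontr)
  assume contr: "\<not> thesis"
  let ?G = "{B \<in> constructible_ideals S. \<exists>Z\<in>F. Z \<inter> X \<subseteq> B}"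
  have F: "ideal_filter S F"
    using assms by (simp add: maximal_ideal_filter_def)
  then have FX: "F \<subseteq> ?G" and X: "X \<in> ?G"
    using assms(2) by (auto simp: ideal_filter_def)
  have "A \<inter> B \<in> ?G" if AB: "A \<in> ?G" "B \<in> ?G" for A B
  proof -
    obtain Z W where "Z \<in> F" "W \<in> F" "Z \<inter> X \<subseteq> A" "W \<inter> X \<subseteq> B"
      using AB by blast
    moreover from this have "Z \<inter> W \<in> F"
      using ideal_filter_Int[OF F] by blast
    moreover have "A \<inter> B \<in> constructible_ideals S"
      using AB Int_constructible by simp
    ultimately show ?thesis
      by blast
  qed
  moreover have "{} \<notin> ?G"
    using contr that by blast
  moreover have "B \<in> ?G" if "A \<in> ?G" "B \<in> constructible_ideals S" "A \<subseteq> B" for A B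
    using that by (auto intro: order_trans)
  moreover have "?G \<noteq> {}" "?G \<subseteq> constructible_ideals S"
    using X by auto
  ultimately have "ideal_filter S ?G"
    unfolding ideal_filter_def by meson
  then have "?G = F"
    using assms(1) FX by (auto simp: maximal_ideal_filter_def)
  then show False
    using X assms(3) by simp
qed

lemma maximal_ideal_filter_disjoint_finite:
  assumes F: "maximal_ideal_filter S F" and X: "X \<in> F"
  shows "\<lbrakk>finite \<X>; \<X> \<subseteq> constructible_ideals S; \<X> \<inter> F = {}\<rbrakk>
    \<Longrightarrow> \<exists>Z\<in>F. Z \<subseteq> X \<and> (\<forall>A\<in>\<X>. Z \<inter> A = {})"
proof (induction \<X> rule: finite_induct)
  case (insert A \<X>)
  then obtain Z where Z: "Z \<in> F" "Z \<subseteq> X" "\<forall>A\<in>\<X>. Z \<inter> A = {}"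
    by auto
  obtain W where W: "W \<in> F" "W \<inter> A = {}"
    using maximal_ideal_filter_disjoint[OF F, of A] insert.prems by auto
  have "Z \<inter> W \<in> F"
    using ideal_filter_Int[OF maximal_ideal_filter_imp_filter[OF F]] Z W by blast
  then show ?case
    using Z W by (intro bexI[of _ "Z \<inter> W"]) auto
qed (use X in auto)

lemma maximal_ideal_filter_carrier:
  assumes "maximal_ideal_filter S F"
  shows "carrier S \<in> F"
proof -
  obtain A where "A \<in> F" "A \<in> constructible_ideals S"
    using assms unfolding maximal_ideal_filter_def ideal_filter_def by blast
  then show ?thesis
    using assms constructible_subset[of A] carrier_constructible
    unfolding maximal_ideal_filter_def ideal_filter_def by blast
qed

text \<open>The indicator of a maximal filter lies in the spectrum because finitely many non-members
  can be avoided simultaneously inside a member: any point of the resulting member has a point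
  character with the prescribed values.\<close>

lemma maximal_ideal_filter_character:
  assumes F: "maximal_ideal_filter S F"
  obtains \<chi> where "\<chi> \<in> max_spectrum S" "\<And>A. A \<in> constructible_ideals S \<Longrightarrow> \<chi> A = (if A \<in> F then 1 else 0)"
proof -
  let ?J = "constructible_ideals S"
  define \<chi> :: "'a set \<Rightarrow> nat" where "\<chi> = (\<lambda>A\<in>?J. if A \<in> F then 1 else 0)"
  have filter: "ideal_filter S F"
    using F by (simp add: maximal_ideal_filter_def)
  have Int: "A \<inter> B \<in> F \<longleftrightarrow> A \<in> F \<and> B \<in> F" if "A \<in> ?J" "B \<in> ?J" for A B
    using filter that unfolding ideal_filter_def by (meson inf_le1 inf_le2)
  have "\<chi> \<in> ?J \<rightarrow>\<^sub>E {0, 1}"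
    by (auto simp: \<chi>_def)
  moreover have "\<chi> (carrier S) \<noteq> 0"
    using maximal_ideal_filter_carrier[OF F] carrier_constructible by (simp add: \<chi>_def)
  moreover have "\<chi> (A \<inter> B) = \<chi> A * \<chi> B" if "A \<in> ?J" "B \<in> ?J" for A B
    using that by (simp add: \<chi>_def Int Int_constructible)
  ultimately have char: "\<chi> \<in> characters S"
    using carrier_constructible unfolding characters_def by blast
  have "\<exists>s\<in>carrier S. \<forall>A\<in>G. point_character S s A = \<chi> A" if G: "finite G" "G \<subseteq> ?J" for G
  proof -
    have GF: "finite (G \<inter> F)" "G \<inter> F \<subseteq> ?J" "\<forall>A\<in>G \<inter> F. \<chi> A = 1"
      using G by (auto simp: \<chi>_def)
    then have "\<chi> (carrier S \<inter> \<Inter>(G \<inter> F)) = 1"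
      using character_carrier_Int_Inter[OF char] by blast
    then have "carrier S \<inter> \<Inter>(G \<inter> F) \<in> F"
      using carrier_Int_Inter_constructible[OF GF(1,2)] by (simp add: \<chi>_def split: if_splits)
    \<comment> \<open>\<open>Z\<close> lies in all members of \<open>G\<close> with value 1 and
      misses all those with value 0.\<close>
    then obtain Z where Z: "Z \<in> F" "Z \<subseteq> carrier S \<inter> \<Inter>(G \<inter> F)" "\<forall>A\<in>G - F. Z \<inter> A = {}"
      using maximal_ideal_filter_disjoint_finite[OF F, of "carrier S \<inter> \<Inter>(G \<inter> F)" "G - F"] G
      by (metis Diff_disjoint Diff_subset Int_commute finite_Diff order_trans)
    moreover obtain s where "s \<in> Z"
      using ideal_filter_nonempty[OF filter Z(1)] by blast
    ultimately show ?thesis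
      using G(2) by (intro bexI[of _ s]) (auto simp: \<chi>_def subset_iff)
  qed
  then have "\<chi> \<in> spectrum S"
    using char by (simp add: spectrum_iff)
  moreover have "{X \<in> ?J. \<chi> X = 1} = F"
    using filter by (auto simp: \<chi>_def ideal_filter_def)
  ultimately have "\<chi> \<in> max_spectrum S"
    using F by (simp add: max_spectrum_def)
  then show thesis
    using that by (simp add: \<chi>_def)
qed

text \<open>Approximate \<open>\<chi>\<close> on \<open>X\<close> and \<open>\<F>\<close> by a
  character of a maximal filter. If that vanished on \<open>\<F>\<close>, its filter would contain a
  nonempty ideal inside \<open>X\<close> disjoint from all of \<open>\<F>\<close>.\<close>

lemma boundary_foundation_set:
  assumes \<chi>: "\<chi> \<in> boundary_spectrum S" and X: "X \<in> constructible_ideals S" "\<chi> X = 1"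
    and \<F>: "foundation_set S \<F> X"
  shows "\<exists>A\<in>\<F>. \<chi> A = 1"
proof -
  have fin: "finite (insert X \<F>)" "insert X \<F> \<subseteq> constructible_ideals S"
    using X \<F> by (auto simp: foundation_set_def)
  obtain \<psi> where \<psi>: "\<psi> \<in> max_spectrum S" "\<forall>A\<in>insert X \<F>. \<psi> A = \<chi> A"
    using \<chi> fin unfolding boundary_iff by meson
  let ?F = "{A \<in> constructible_ideals S. \<psi> A = 1}"
  have F: "maximal_ideal_filter S ?F"
    using \<psi>(1) by (simp add: max_spectrum_def)
  have False if none: "\<forall>A\<in>\<F>. \<psi> A \<noteq> 1"
  proof -
    have "X \<in> ?F" "\<F> \<inter> ?F = {}"
      using \<psi>(2) X none by auto
    then obtain Z where Z: "Z \<in> ?F" "Z \<subseteq> X" "\<forall>A\<in>\<F>. Z \<inter> A = {}"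
      using maximal_ideal_filter_disjoint_finite[OF F, of X \<F>] fin by auto
    then have "Z \<noteq> {}"
      using ideal_filter_nonempty[OF maximal_ideal_filter_imp_filter[OF F]] by blast
    moreover have "Z \<in> constructible_ideals S"
      using Z(1) by simp
    ultimately have "\<exists>A\<in>\<F>. Z \<inter> A \<noteq> {}"
      using \<F> Z(2) unfolding foundation_set_def by metis
    then show False
      using Z(3) by metis
  qed
  then show ?thesis
    using \<psi>(2) by auto
qed

section \<open>Germs\<close>

text \<open>For reflexivity the ideal of agreement is \<open>dom g\<close>; for transitivity it is
  the intersection of the two given ones, on which \<open>\<chi>\<close> is 1 by
  multiplicativity.\<close>

lemma equiv_germ_rel: "equiv (germ_pairs S) (germ_rel S)"
proof (rule equivI)
  show "germ_rel S \<subseteq> germ_pairs S \<times> germ_pairs S"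
    by (auto simp: germ_rel_def)
  show "refl_on (germ_pairs S) (germ_rel S)"
  proof (rule refl_onI)
    fix p assume "p \<in> germ_pairs S"
    then show "(p, p) \<in> germ_rel S"
      using dom_constructible by (fastforce simp: germ_rel_def germ_pairs_def)
  qed
  show "sym (germ_rel S)"
    by (rule symI) (fastforce simp: germ_rel_def)
  show "trans (germ_rel S)"
  proof (rule transI)
    fix p q r assume pq: "(p, q) \<in> germ_rel S" and qr: "(q, r) \<in> germ_rel S"
    obtain f g h \<chi> where eq: "p = (f, \<chi>)" "q = (g, \<chi>)" "r = (h, \<chi>)"
      using pq qr by (auto simp: germ_rel_def)
    obtain A B where AB: "A \<in> constructible_ideals S" "B \<in> constructible_ideals S"
      "\<chi> A = 1" "\<chi> B = 1" "f |` A = g |` A" "g |` B = h |` B"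
      using pq qr unfolding eq germ_rel_def by auto
    have \<chi>: "\<chi> \<in> characters S"
      using pq spectrum_subset unfolding eq germ_rel_def germ_pairs_def by auto
    have "\<chi> (A \<inter> B) = 1" "f |` (A \<inter> B) = h |` (A \<inter> B)"
      using AB character_Int[OF \<chi>] by (auto simp: restrict_map_eq_iff)
    then show "(p, r) \<in> germ_rel S"
      using pq qr AB Int_constructible[of A B] unfolding eq germ_rel_def by auto
  qed
qed

lemma germ_eqI:
  assumes "g \<in> left_inverse_hull S" "h \<in> left_inverse_hull S" "\<chi> \<in> spectrum S"
    and "\<chi> (dom g) = 1" "\<chi> (dom h) = 1"
    and "A \<in> constructible_ideals S" "\<chi> A = 1" "\<And>x. x \<in> A \<Longrightarrow> g x = h x"
  shows "germ S g \<chi> = germ S h \<chi>"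
proof -
  have "((g, \<chi>), (h, \<chi>)) \<in> germ_rel S"
    using assms by (auto simp: germ_rel_def germ_pairs_def restrict_map_eq_iff)
  then show ?thesis
    unfolding germ_def by (rule equiv_class_eq[OF equiv_germ_rel])
qed

lemma germ_eqD:
  assumes "(g, \<chi>) \<in> germ_pairs S" "(h, \<psi>) \<in> germ_pairs S" "germ S g \<chi> = germ S h \<psi>"
  shows "\<chi> = \<psi> \<and> (\<exists>A\<in>constructible_ideals S. \<chi> A = 1 \<and> (\<forall>x\<in>A. g x = h x))"
proof -
  have "((g, \<chi>), (h, \<psi>)) \<in> germ_rel S"
    using assms eq_equiv_class_iff[OF equiv_germ_rel] by (simp add: germ_def)
  then show ?thesis
    by (auto simp: germ_rel_def restrict_map_eq_iff)
qed

lemma germ_pairsI: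
  "\<lbrakk>g \<in> left_inverse_hull S; \<chi> \<in> spectrum S; \<chi> (dom g) = 1\<rbrakk> \<Longrightarrow> (g, \<chi>) \<in> germ_pairs S"
  by (simp add: germ_pairs_def)

lemma unit_germ_pair: "\<chi> \<in> spectrum S \<Longrightarrow> (partial_id (carrier S), \<chi>) \<in> germ_pairs S"
  using character_carrier partial_id_carrier_hull spectrum_subset
  by (auto simp: germ_pairs_def partial_id_def)

lemma germ_mem: "(g, \<chi>) \<in> germ_pairs S \<Longrightarrow> (g, \<chi>) \<in> germ S g \<chi>"
  unfolding germ_def by (rule equiv_class_self[OF equiv_germ_rel])

lemma germ_in_gpd: "(g, \<chi>) \<in> germ_pairs S \<Longrightarrow> germ S g \<chi> \<in> gpd S"
  unfolding gpd_def germ_def by (rule quotientI)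

lemma gpd_source_germ:
  assumes "(g, \<chi>) \<in> germ_pairs S"
  shows "gpd_source (germ S g \<chi>) = \<chi>"
  unfolding gpd_source_def
proof (rule the_equality)
  show "\<exists>h. (h, \<chi>) \<in> germ S g \<chi>"
    using germ_mem[OF assms] by blast
qed (auto simp: germ_def germ_rel_def)

lemma gpdE:
  assumes "\<gamma> \<in> gpd S"
  obtains g where "(g, gpd_source \<gamma>) \<in> germ_pairs S" "\<gamma> = germ S g (gpd_source \<gamma>)"
proof -
  obtain p where "p \<in> germ_pairs S" "\<gamma> = germ_rel S `` {p}"
    using assms unfolding gpd_def by (rule quotientE)
  then obtain g \<chi> where "(g, \<chi>) \<in> germ_pairs S" "\<gamma> = germ S g \<chi>"
    by (cases p) (auto simp: germ_def)
  then show thesis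
    using that gpd_source_germ by metis
qed

text \<open>The range does not depend on the representative: two representatives have preimages that
  agree inside an ideal \<open>A\<close> with \<open>\<chi> A = 1\<close>, and intersecting with
  such an \<open>A\<close> does not change \<open>\<chi>\<close>.\<close>

lemma gpd_range_germ:
  assumes g: "(g, \<chi>) \<in> germ_pairs S"
  shows "gpd_range S (germ S g \<chi>) = push_character S g \<chi>"
  unfolding gpd_range_def
proof (rule the_equality)
  show "\<exists>h \<psi>. (h, \<psi>) \<in> germ S g \<chi> \<and> push_character S g \<chi> = push_character S h \<psi>"
    using germ_mem[OF assms] by blast
next
  fix \<rho> assume "\<exists>h \<psi>. (h, \<psi>) \<in> germ S g \<chi> \<and> \<rho> = push_character S h \<psi>"
  then obtain h A where h: "(h, \<chi>) \<in> germ_pairs S" "\<rho> = push_character S h \<chi>"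
    and A: "A \<in> constructible_ideals S" "\<chi> A = 1" "\<forall>x\<in>A. g x = h x"
    by (auto simp: germ_def germ_rel_def restrict_map_eq_iff)
  have \<chi>: "\<chi> \<in> characters S"
    using g spectrum_subset by (auto simp: germ_pairs_def)
  have "\<chi> (h -` Some ` X) = \<chi> (g -` Some ` X)" if "X \<in> constructible_ideals S" for X
  proof -
    have "h -` Some ` X \<in> constructible_ideals S" "g -` Some ` X \<in> constructible_ideals S"
      using g h that preimage_constructible by (auto simp: germ_pairs_def)
    moreover have "A \<inter> h -` Some ` X = A \<inter> g -` Some ` X"
      using A(3) by auto
    ultimately show ?thesis
      using character_Int[OF \<chi> A(1)] A(2) by (metis mult_1)
  qed
  then show "\<rho> = push_character S g \<chi>"
    unfolding h(2) push_character_def by (intro restrict_ext)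
qed

lemma push_character_inj:
  assumes g: "g \<in> left_inverse_hull S"
    and "\<chi> \<in> characters S" "\<chi> (dom g) = 1" "\<psi> \<in> characters S" "\<psi> (dom g) = 1"
    and eq: "push_character S g \<chi> = push_character S g \<psi>"
  shows "\<chi> = \<psi>"
proof -
  have "\<chi> A = \<psi> A" if A: "A \<in> constructible_ideals S" for A
  proof -
    \<comment> \<open>\<open>?B\<close> is the image of \<open>A\<close> under \<open>g\<close>;
      evaluating the pushed characters there returns their values on
      \<open>A \<inter> dom g\<close>, which are those on \<open>A\<close>.\<close>
    let ?B = "partial_inverse g -` Some ` A"
    have B: "?B \<in> constructible_ideals S"
      using preimage_constructible[OF left_inverse_hull.inverse[OF g] A] .
    have "x \<in> g -` Some ` ?B \<longleftrightarrow> x \<in> A \<inter> dom g" for x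
    proof (cases "g x")
      case (Some z)
      then have "partial_inverse g z = Some x"
        by (simp add: partial_inverse_iff[OF hull_inj[OF g]])
      with Some show ?thesis
        by (auto simp: image_iff)
    qed auto
    then have "g -` Some ` ?B = A \<inter> dom g"
      by (rule Set.set_eqI)
    then have "\<chi> (A \<inter> dom g) = \<psi> (A \<inter> dom g)"
      using fun_cong[OF eq, of ?B] B by (simp add: push_character_def)
    then show ?thesis
      using assms A dom_constructible[OF g] by (simp add: character_Int)
  qed
  then show ?thesis
    using assms(2,4) by (intro PiE_ext[of \<chi> "constructible_ideals S" "\<lambda>_. {0, 1}"]) (auto simp: characters_def)
qed

text \<open>Continuity of \<psi> \<mapsto> \<open>germ S h \<psi>\<close> at \<open>\<chi>\<close>,
  by induction on the generated topology. A basic set may be given by another map \<open>g\<close>,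
  but \<open>g\<close> and \<open>h\<close> then agree on an ideal with value 1 at
  \<open>\<chi>\<close>, hence define equal germs at all nearby characters.\<close>

lemma openin_gpd_neighbourhood:
  assumes "openin (gpd_topology S) B" "(h, \<chi>) \<in> germ_pairs S" "germ S h \<chi> \<in> B"
  obtains V where "openin (spectrum_topology S) V" "\<chi> \<in> V"
    "\<And>\<psi>. \<psi> \<in> V \<Longrightarrow> (h, \<psi>) \<in> germ_pairs S \<and> germ S h \<psi> \<in> B"
proof -
  let ?P = "\<lambda>B V. openin (spectrum_topology S) V \<and> \<chi> \<in> V \<and>
      (\<forall>\<psi>\<in>V. (h, \<psi>) \<in> germ_pairs S \<and> germ S h \<psi> \<in> B)"
  have "germ S h \<chi> \<in> B \<longrightarrow> (\<exists>V. ?P B V)"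
    using assms(1) unfolding gpd_topology_def openin_topology_generated_by_iff
  proof (induction rule: generate_topology_on.induct)
    case (Int B C)
    show ?case
    proof
      assume "germ S h \<chi> \<in> B \<inter> C"
      then obtain V W where "?P B V" "?P C W"
        using Int by blast
      then show "\<exists>V. ?P (B \<inter> C) V"
        by (intro exI[of _ "V \<inter> W"]) auto
    qed
  next
    case (UN K)
    show ?case
    proof
      assume "germ S h \<chi> \<in> \<Union>K"
      then obtain B where "B \<in> K" "germ S h \<chi> \<in> B"
        by blast
      then obtain V where "?P B V"
        using UN by blast
      then show "\<exists>V. ?P (\<Union>K) V"
        using \<open>B \<in> K\<close> by blast
    qed
  next
    case (Basis B)
    then obtain g U where gU: "B = germ S g ` U" "g \<in> left_inverse_hull S"
      "openin (spectrum_topology S) U" "U \<subseteq> {\<chi> \<in> spectrum S. \<chi> (dom g) = 1}"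
      by blast
    show ?case
    proof
      assume "germ S h \<chi> \<in> B"
      then obtain \<psi> where \<psi>: "\<psi> \<in> U" "germ S h \<chi> = germ S g \<psi>"
        using gU by blast
      then have "(g, \<psi>) \<in> germ_pairs S"
        using gU by (intro germ_pairsI) auto
      then obtain A where A: "\<chi> = \<psi>" "A \<in> constructible_ideals S" "\<chi> A = 1" "\<forall>x\<in>A. h x = g x"
        using germ_eqD[OF assms(2)] \<psi>(2) by blast
      have h: "h \<in> left_inverse_hull S" "\<chi> (dom h) = 1" "\<chi> \<in> spectrum S"
        using assms(2) by (auto simp: germ_pairs_def)
      let ?V = "U \<inter> ({\<psi> \<in> spectrum S. \<psi> A = 1} \<inter> {\<psi> \<in> spectrum S. \<psi> (dom h) = 1})"
      have "openin (spectrum_topology S) ?V"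
        using gU(3) A(2) h(1) by (intro openin_Int openin_spectrum_eval dom_constructible)
      moreover have "\<chi> \<in> ?V"
        using A \<psi> h by auto
      moreover have "(h, \<theta>) \<in> germ_pairs S \<and> germ S h \<theta> \<in> B" if \<theta>: "\<theta> \<in> ?V" for \<theta>
      proof -
        have "germ S h \<theta> = germ S g \<theta>"
          using \<theta> gU h A by (intro germ_eqI[of _ _ _ A]) auto
        then show ?thesis
          using \<theta> gU h by (auto intro: germ_pairsI)
      qed
      ultimately show "\<exists>V. ?P B V"
        by blast
    qed
  qed simp
  then show thesis
    using assms(3) that by blast
qed

lemma basic_bisection:
  assumes g: "g \<in> left_inverse_hull S"
  defines "B \<equiv> germ S g ` {\<psi> \<in> spectrum S. \<psi> (dom g) = 1}"
  shows "openin (gpd_topology S) B" "bisection S B"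
proof -
  let ?U = "{\<psi> \<in> spectrum S. \<psi> (dom g) = 1}"
  show "openin (gpd_topology S) B"
    unfolding gpd_topology_def openin_topology_generated_by_iff B_def
    using g openin_spectrum_eval[OF dom_constructible[OF g]]
    by (intro generate_topology_on.Basis) blast
  have pairs: "(g, \<psi>) \<in> germ_pairs S" if "\<psi> \<in> ?U" for \<psi>
    using that g by (simp add: germ_pairs_def)
  have "inj_on gpd_source B"
    unfolding B_def by (rule inj_onI) (auto simp: gpd_source_germ pairs)
  moreover have "inj_on (gpd_range S) B"
  proof (rule inj_onI)
    fix \<gamma> \<delta> assume "\<gamma> \<in> B" "\<delta> \<in> B" and eq: "gpd_range S \<gamma> = gpd_range S \<delta>"
    then obtain \<chi> \<psi> where \<chi>: "\<chi> \<in> ?U" "\<gamma> = germ S g \<chi>" and \<psi>: "\<psi> \<in> ?U" "\<delta> = germ S g \<psi>"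
      unfolding B_def by blast
    then have "push_character S g \<chi> = push_character S g \<psi>"
      using eq by (simp add: gpd_range_germ pairs)
    then have "\<chi> = \<psi>"
      using \<chi> \<psi> push_character_inj[OF g, of \<chi> \<psi>] spectrum_subset by auto
    then show "\<gamma> = \<delta>"
      using \<chi> \<psi> by simp
  qed
  ultimately show "bisection S B"
    unfolding bisection_def using germ_in_gpd pairs by (auto simp: B_def)
qed

section \<open>The equivalence\<close>

text \<open>The data of (C) depend on finitely many ideals near \<open>\<chi>\<close>, so (C)
  becomes a covering to which regularity applies; the foundation set obtained makes one of the germs
  a unit.\<close>

lemma regular_imp_not_condition_C:
  assumes reg: "strongly_regular_on_boundary S" and \<chi>: "\<chi> \<in> boundary_spectrum S"
  shows "\<not> condition_C S \<chi>"
proof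
  let ?J = "constructible_ideals S"
  assume "condition_C S \<chi>"
  then obtain n :: nat and g B U V where
    C: "\<forall>k\<in>{1..n}. g k \<in> isotropy S \<chi> - {gpd_unit S \<chi>} \<and>
        openin (gpd_topology S) (B k) \<and> bisection S (B k) \<and> g k \<in> B k"
    and V: "openin (spectrum_topology S) V" "\<chi> \<in> V" "V \<subseteq> U"
    and cover: "gpd_unit S ` (point_characters S \<inter> U) \<subseteq> (\<Union>k\<in>{1..n}. B k)"
    unfolding condition_C_def by (elim exE conjE) (rule that)
  have g: "g k \<in> isotropy S \<chi> - {gpd_unit S \<chi>}"
    and B: "openin (gpd_topology S) (B k) \<and> bisection S (B k) \<and> g k \<in> B k"
    if "k \<in> {1..n}" for k
    using C[rule_format, OF that] by simp_all
  have \<chi>_spec: "\<chi> \<in> spectrum S" and \<chi>_char: "\<chi> \<in> characters S"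
    using \<chi> spectrum_subset by (auto simp: boundary_iff)
  \<comment> \<open>\<open>h\<close> represents the germ, and agreement with \<open>\<chi>\<close>
    on the finite set \<open>F\<close> keeps the germ of \<open>h\<close> inside the
    bisection.\<close>
  have "\<exists>h F. (h, \<chi>) \<in> germ_pairs S \<and> g k = germ S h \<chi> \<and> finite F \<and> F \<subseteq> ?J \<and>
      (\<forall>\<psi>\<in>spectrum S. (\<forall>A\<in>F. \<psi> A = \<chi> A) \<longrightarrow> (h, \<psi>) \<in> germ_pairs S \<and> germ S h \<psi> \<in> B k)"
    if k: "k \<in> {1..n}" for k
  proof -
    have "g k \<in> gpd S" "gpd_source (g k) = \<chi>"
      using g[OF k] by (auto simp: isotropy_def)
    then obtain h where h: "(h, \<chi>) \<in> germ_pairs S" "g k = germ S h \<chi>"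
      using gpdE by metis
    obtain W where W: "openin (spectrum_topology S) W" "\<chi> \<in> W"
      "\<And>\<psi>. \<psi> \<in> W \<Longrightarrow> (h, \<psi>) \<in> germ_pairs S \<and> germ S h \<psi> \<in> B k"
      using openin_gpd_neighbourhood[OF _ h(1), of "B k"] B[OF k] h(2) by metis
    then show ?thesis
      using spectrum_neighbourhood_cylinder[OF W(1,2)] h by metis
  qed
  then obtain h F where h: "\<And>k. k \<in> {1..n} \<Longrightarrow> (h k, \<chi>) \<in> germ_pairs S \<and> g k = germ S (h k) \<chi>"
    and F: "\<And>k. k \<in> {1..n} \<Longrightarrow> finite (F k) \<and> F k \<subseteq> ?J"
    and hF: "\<And>k \<psi>. \<lbrakk>k \<in> {1..n}; \<psi> \<in> spectrum S; \<forall>A\<in>F k. \<psi> A = \<chi> A\<rbrakk>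
      \<Longrightarrow> (h k, \<psi>) \<in> germ_pairs S \<and> germ S (h k) \<psi> \<in> B k"
    by metis
  obtain F0 where F0: "finite F0" "F0 \<subseteq> ?J"
    "\<And>\<psi>. \<lbrakk>\<psi> \<in> spectrum S; \<forall>A\<in>F0. \<psi> A = \<chi> A\<rbrakk> \<Longrightarrow> \<psi> \<in> V"
    using spectrum_neighbourhood_cylinder[OF V(1,2)] by blast
  define G where "G = F0 \<union> (\<Union>k\<in>{1..n}. F k)"
  have G: "finite G" "G \<subseteq> ?J"
    unfolding G_def using F F0(1,2) by (simp, blast)
  \<comment> \<open>\<open>X\<close> and \<open>\<X>\<close> encode the cylinder of
    \<open>\<chi>\<close> over \<open>G\<close>: ideals of value 1 are intersected, those of value 0
    are removed after being cut down to subsets of \<open>X\<close>.\<close>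
  define X where "X = carrier S \<inter> \<Inter>{A \<in> G. \<chi> A = 1}"
  define \<X> where "\<X> = (\<lambda>A. A \<inter> X) ` {A \<in> G. \<chi> A = 0}"
  have X: "X \<in> ?J" "\<chi> X = 1"
    using G character_carrier_Int_Inter[OF \<chi>_char, of "{A \<in> G. \<chi> A = 1}"]
      carrier_Int_Inter_constructible[of "{A \<in> G. \<chi> A = 1}"] by (auto simp: X_def)
  have \<X>: "finite \<X>" "\<X> \<subseteq> ?J" "\<forall>A\<in>\<X>. A \<subseteq> X \<and> \<chi> A = 0"
    using G X character_Int[OF \<chi>_char] Int_constructible by (auto simp: \<X>_def)
  have diff: "X - \<Union>\<X> = {s \<in> carrier S. \<forall>A\<in>G. point_character S s A = \<chi> A}"
  proof (rule Set.set_eqI)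
    fix s
    have "point_character S s A = \<chi> A \<longleftrightarrow> (\<chi> A = 1 \<longrightarrow> s \<in> A) \<and> (\<chi> A = 0 \<longrightarrow> s \<notin> A)" if "A \<in> G" for A
      using character_range[OF \<chi>_char subsetD[OF G(2) that]] point_character_apply[OF subsetD[OF G(2) that], of s]
      by (metis zero_neq_one)
    moreover have "s \<in> X - \<Union>\<X> \<longleftrightarrow>
        s \<in> carrier S \<and> (\<forall>A\<in>G. (\<chi> A = 1 \<longrightarrow> s \<in> A) \<and> (\<chi> A = 0 \<longrightarrow> s \<notin> A))"
      unfolding X_def \<X>_def by blast
    ultimately show "s \<in> X - \<Union>\<X> \<longleftrightarrow> s \<in> {s \<in> carrier S. \<forall>A\<in>G. point_character S s A = \<chi> A}"
      by simp
  qed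
  \<comment> \<open>Density of the point characters in the spectrum provides a point in the
    cylinder.\<close>
  have "X - \<Union>\<X> \<noteq> {}"
    using \<chi>_spec G unfolding diff spectrum_iff by blast
  moreover have "X - \<Union>\<X> \<subseteq> (\<Union>h\<in>h ` {1..n}. {s \<in> carrier S. h s = Some s})"
  proof
    fix s assume "s \<in> X - \<Union>\<X>"
    then have s: "s \<in> carrier S" "\<forall>A\<in>G. point_character S s A = \<chi> A"
      unfolding diff by auto
    let ?\<psi> = "point_character S s"
    have \<psi>: "?\<psi> \<in> spectrum S"
      using point_character_spectrum[OF s(1)] .
    then have "?\<psi> \<in> U"
      using F0(3)[of ?\<psi>] s(2) V(3) by (auto simp: G_def)
    then obtain k where k: "k \<in> {1..n}" "gpd_unit S ?\<psi> \<in> B k"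
      using cover s(1) by blast
    have hk: "(h k, ?\<psi>) \<in> germ_pairs S" "germ S (h k) ?\<psi> \<in> B k"
      using hF[OF k(1) \<psi>] s(2) k(1) unfolding G_def by blast+
    \<comment> \<open>Both germs lie in the bisection \<open>B k\<close> and have source
      \<open>?\<psi>\<close>.\<close>
    have "germ S (h k) ?\<psi> = gpd_unit S ?\<psi>"
    proof (rule inj_onD[of gpd_source "B k"])
      show "inj_on gpd_source (B k)"
        using B[OF k(1)] by (simp add: bisection_def)
      show "gpd_source (germ S (h k) ?\<psi>) = gpd_source (gpd_unit S ?\<psi>)"
        using gpd_source_germ hk(1) unit_germ_pair[OF \<psi>] by (simp add: gpd_unit_def)
    qed (use hk k in auto)
    then obtain A where "A \<in> ?J" "?\<psi> A = 1" "\<forall>x\<in>A. h k x = partial_id (carrier S) x"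
      using germ_eqD[OF hk(1) unit_germ_pair[OF \<psi>]] unfolding gpd_unit_def by blast
    \<comment> \<open>The value 1 of the point character at \<open>A\<close> says that
      \<open>s\<close> lies in \<open>A\<close>, where \<open>h k\<close> is the identity.\<close>
    then have "h k s = Some s"
      using s(1) by (simp add: partial_id_def split: if_splits)
    then show "s \<in> (\<Union>h\<in>h ` {1..n}. {s \<in> carrier S. h s = Some s})"
      using s(1) k(1) by auto
  qed
  moreover have "h ` {1..n} \<subseteq> left_inverse_hull S"
    using h by (auto simp: germ_pairs_def)
  ultimately obtain \<Y> where \<Y>: "\<Y> \<subseteq> ?J" "foundation_set S (\<X> \<union> \<Y>) X"
    "\<forall>Y\<in>\<Y>. \<exists>h\<in>h ` {1..n}. h \<circ>\<^sub>m partial_id Y = partial_id Y"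
    using reg[unfolded strongly_regular_on_boundary_def, rule_format, of "h ` {1..n}" X \<X>] X(1) \<X>
    by blast
  \<comment> \<open>The ideal with value 1 belongs to \<open>\<Y>\<close>, since
    \<open>\<chi>\<close> vanishes on \<open>\<X>\<close>.\<close>
  obtain Y where Y: "Y \<in> \<Y>" "\<chi> Y = 1"
    using boundary_foundation_set[OF \<chi> X \<Y>(2)] \<X>(3) by auto
  then obtain k where k: "k \<in> {1..n}" "\<forall>y\<in>Y. h k y = Some y"
    using \<Y>(3) by (auto simp: comp_partial_id_eq_iff)
  have "Y \<in> ?J"
    using Y \<Y> by blast
  have "germ S (h k) \<chi> = gpd_unit S \<chi>"
    unfolding gpd_unit_def
    using h[OF k(1)] unit_germ_pair[OF \<chi>_spec] Y(2) \<open>Y \<in> ?J\<close> k(2) constructible_subset[OF \<open>Y \<in> ?J\<close>]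
    by (intro germ_eqI[of _ _ _ Y]) (auto simp: germ_pairs_def partial_id_def restrict_map_def)
  then show False
    using g[OF k(1)] h[OF k(1)] by simp
qed

section \<open>Condition (C) from a failure of regularity\<close>

text \<open>
  Such a \<open>\<chi>\<close> exists by compactness: otherwise finitely many sets fixed pointwise by elements of
  \<open>H\<close> would complete \<open>\<X>\<close> to a foundation set.
\<close>

lemma boundary_character_avoiding_fixed:
  assumes X: "X \<in> constructible_ideals S"
    and \<X>: "finite \<X>" "\<X> \<subseteq> constructible_ideals S" "\<forall>A\<in>\<X>. A \<subseteq> X"
    and none: "\<nexists>\<Y>. finite \<Y> \<and> \<Y> \<subseteq> constructible_ideals S \<and>
            (\<forall>Y\<in>\<Y>. \<exists>h\<in>H. h \<circ>\<^sub>m partial_id Y = partial_id Y) \<and>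
            foundation_set S (\<X> \<union> \<Y>) X"
  obtains \<chi> where "\<chi> \<in> boundary_spectrum S" "\<chi> X = 1" "\<And>A. A \<in> \<X> \<Longrightarrow> \<chi> A = 0"
    "\<And>Y h. \<lbrakk>Y \<in> constructible_ideals S; h \<in> H; \<forall>y\<in>Y. h y = Some y\<rbrakk> \<Longrightarrow> \<chi> Y = 0"
proof -
  let ?J = "constructible_ideals S"
  let ?M = "{\<psi> \<in> max_spectrum S. \<psi> X = 1}"
  \<comment> \<open>Members of a foundation set must lie inside \<open>X\<close>; an arbitrary fixed
    ideal \<open>Y\<close> is handled at the end through \<open>Y \<inter> X\<close>.\<close>
  let ?\<Y> = "{Y \<in> ?J. Y \<subseteq> X \<and> (\<exists>h\<in>H. \<forall>y\<in>Y. h y = Some y)}"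
  have M: "?M \<subseteq> characters S"
    using spectrum_subset by (auto simp: max_spectrum_def)
  have "\<exists>\<psi>\<in>?M. \<forall>A\<in>\<D>. \<psi> A = 0" if \<D>: "finite \<D>" "\<D> \<subseteq> \<X> \<union> ?\<Y>" for \<D>
  proof -
    \<comment> \<open>The members of \<open>\<D>\<close> outside \<open>\<X>\<close> are fixed
      ideals, hence an admissible choice of \<open>\<Y>\<close> that fails by \<open>none\<close>;
      the failure yields a nonempty \<open>Z\<close> disjoint from all of
      \<open>\<D>\<close>.\<close>
    have "finite (\<D> - \<X>)" "\<D> - \<X> \<subseteq> ?J"
      "\<forall>Y\<in>\<D> - \<X>. \<exists>h\<in>H. h \<circ>\<^sub>m partial_id Y = partial_id Y"
      unfolding comp_partial_id_eq_iff using \<D> by auto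
    then have "\<not> foundation_set S (\<X> \<union> (\<D> - \<X>)) X"
      using none by metis
    moreover have "finite (\<X> \<union> (\<D> - \<X>))" "\<X> \<union> (\<D> - \<X>) \<subseteq> ?J"
      using \<X> \<D> by auto
    moreover have "\<forall>A\<in>\<X> \<union> (\<D> - \<X>). A \<subseteq> X"
      using \<X>(3) \<D>(2) by blast
    ultimately have "\<not> (\<forall>Z\<in>?J. Z \<noteq> {} \<and> Z \<subseteq> X \<longrightarrow> (\<exists>A\<in>\<X> \<union> (\<D> - \<X>). Z \<inter> A \<noteq> {}))"
      unfolding foundation_set_def by argo
    then obtain Z where Z: "Z \<in> ?J" "Z \<noteq> {}" "Z \<subseteq> X" "\<forall>A\<in>\<X> \<union> (\<D> - \<X>). Z \<inter> A = {}"
      by meson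
    obtain F where F: "maximal_ideal_filter S F" "Z \<in> F"
      using maximal_ideal_filter_exists[OF Z(1,2)] by blast
    obtain \<psi> where \<psi>: "\<psi> \<in> max_spectrum S" "\<And>A. A \<in> ?J \<Longrightarrow> \<psi> A = (if A \<in> F then 1 else 0)"
      using maximal_ideal_filter_character[OF F(1)] by blast
    have filter: "ideal_filter S F"
      using F(1) by (simp add: maximal_ideal_filter_def)
    then have "X \<in> F"
      using ideal_filter_mono[OF _ F(2) X Z(3)] by blast
    moreover have "A \<notin> F" if "A \<in> \<D>" for A
    proof
      assume "A \<in> F"
      then have "Z \<inter> A \<noteq> {}"
        using ideal_filter_nonempty[OF filter ideal_filter_Int[OF filter F(2)]] by simp
      then show False
        using Z(4) that by simp
    qed
    moreover have "\<D> \<subseteq> ?J"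
      using \<D>(2) \<X>(2) by auto
    ultimately show ?thesis
      using \<psi> X by (intro bexI[of _ \<psi>]) auto
  qed
  then obtain \<chi> where \<chi>: "\<chi> \<in> character_topology S closure_of ?M" "\<And>A. A \<in> \<X> \<union> ?\<Y> \<Longrightarrow> \<chi> A = 0"
    using characters_limit[of "\<X> \<union> ?\<Y>" ?M] M \<X>(2) by (smt (verit) Un_iff mem_Collect_eq subset_iff)
  have char: "\<chi> \<in> characters S" and
    approx: "\<And>F. \<lbrakk>finite F; F \<subseteq> ?J\<rbrakk> \<Longrightarrow> \<exists>\<psi>\<in>?M. \<forall>A\<in>F. \<psi> A = \<chi> A"
    using \<chi>(1) unfolding character_closure_iff[OF M] by blast+
  have "\<chi> X = 1"
    using approx[of "{X}"] X by auto
  moreover have "\<chi> \<in> boundary_spectrum S"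
  proof -
    \<comment> \<open>Two approximations are chained: \<open>\<chi>\<close> by characters of maximal
      filters, and these by point characters.\<close>
    have "\<exists>s\<in>carrier S. \<forall>A\<in>F. point_character S s A = \<chi> A" if F: "finite F" "F \<subseteq> ?J" for F
    proof -
      obtain \<psi> where \<psi>: "\<psi> \<in> ?M" "\<forall>A\<in>F. \<psi> A = \<chi> A"
        using approx[OF F] by blast
      then have "\<psi> \<in> spectrum S"
        by (simp add: max_spectrum_def)
      then show ?thesis
        using \<psi>(2) F unfolding spectrum_iff by metis
    qed
    then have "\<chi> \<in> spectrum S"
      using char by (simp add: spectrum_iff)
    then show ?thesis
      using approx unfolding boundary_iff by blast
  qed
  moreover have "\<chi> Y = 0" if Y: "Y \<in> ?J" "h \<in> H" "\<forall>y\<in>Y. h y = Some y" for Y h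
  proof -
    have "Y \<inter> X \<in> ?\<Y>"
      using Y Int_constructible[OF Y(1) X] by blast
    then have "\<chi> (Y \<inter> X) = 0"
      using \<chi>(2) by blast
    then show ?thesis
      using character_Int[OF char Y(1) X] \<open>\<chi> X = 1\<close> by simp
  qed
  ultimately show thesis
    using that \<chi>(2) by blast
qed

text \<open>At a fixed point \<open>s\<close> of \<open>h\<close>, membership in an ideal and in its
  preimage coincide; matching \<open>\<chi>\<close> on both ideals by such an \<open>s\<close>
  transfers the equality to \<open>\<chi>\<close>.\<close>

lemma push_character_fixed:
  assumes h: "h \<in> left_inverse_hull S" and \<chi>: "\<chi> \<in> characters S"
    and approx: "\<And>F. \<lbrakk>finite F; F \<subseteq> constructible_ideals S\<rbrakk>
      \<Longrightarrow> \<exists>s. h s = Some s \<and> (\<forall>A\<in>F. point_character S s A = \<chi> A)"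
  shows "push_character S h \<chi> = \<chi>"
proof -
  have "\<chi> (h -` Some ` A) = \<chi> A" if A: "A \<in> constructible_ideals S" for A
  proof -
    note B = preimage_constructible[OF h A]
    obtain s where "h s = Some s" "\<forall>C\<in>{A, h -` Some ` A}. point_character S s C = \<chi> C"
      using approx[of "{A, h -` Some ` A}"] A B by auto
    then show ?thesis
      using A B by (auto split: if_splits)
  qed
  then show ?thesis
    using \<chi> by (fastforce simp: push_character_def restrict_def characters_def PiE_def extensional_def)
qed

text \<open>Accumulation of fixed points at \<open>\<chi>\<close> makes a germ isotropic, and
  \<open>avoid\<close> makes it differ from the unit. The basic bisections of these germs cover the
  nearby units because \<open>h s = s\<close> makes \<open>h\<close> the identity on
  \<open>sS\<close>.\<close>

lemma condition_C_of_fixed_points: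
  assumes H: "finite H" "H \<subseteq> left_inverse_hull S"
    and X: "X \<in> constructible_ideals S"
    and \<X>: "finite \<X>" "\<X> \<subseteq> constructible_ideals S"
    and cover: "X - \<Union>\<X> \<subseteq> (\<Union>h\<in>H. {s \<in> carrier S. h s = Some s})"
    and \<chi>: "\<chi> \<in> spectrum S" "\<chi> X = 1" "\<And>A. A \<in> \<X> \<Longrightarrow> \<chi> A = 0"
    and avoid: "\<And>Y h. \<lbrakk>Y \<in> constructible_ideals S; h \<in> H; \<forall>y\<in>Y. h y = Some y\<rbrakk> \<Longrightarrow> \<chi> Y = 0"
  shows "condition_C S \<chi>"
proof -
  let ?J = "constructible_ideals S"
  have char: "\<chi> \<in> characters S"
    using \<chi>(1) spectrum_subset by blast
  let ?approx = "\<lambda>h F. \<exists>s. h s = Some s \<and> (\<forall>A\<in>F. point_character S s A = \<chi> A)"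
  \<comment> \<open>The germs at \<open>\<chi>\<close> of the other elements of \<open>H\<close> need not be isotropy elements.\<close>
  define K where "K = {h \<in> H. \<forall>F. finite F \<and> F \<subseteq> ?J \<longrightarrow> ?approx h F}"
  have K: "finite K" "K \<subseteq> H" "K \<subseteq> left_inverse_hull S"
    using H by (auto simp: K_def)
  have "\<forall>h\<in>H - K. \<exists>F. finite F \<and> F \<subseteq> ?J \<and> \<not> ?approx h F"
    by (auto simp: K_def)
  then obtain F where F: "\<forall>h\<in>H - K. finite (F h) \<and> F h \<subseteq> ?J \<and> \<not> ?approx h (F h)"
    by metis
  \<comment> \<open>Agreement on \<open>X\<close> and \<open>\<X>\<close> places \<open>s\<close> in
    the covered set; agreement on each \<open>F h\<close> rules out that a discarded
    \<open>h\<close> fixes \<open>s\<close>. So every point in this cylinder is fixed by an element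
    of \<open>K\<close>.\<close>
  define G where "G = insert X \<X> \<union> (\<Union>h\<in>H - K. F h)"
  have G: "finite G" "G \<subseteq> ?J"
    using F X \<X> H(1) by (auto simp: G_def)
  have fixing: "\<exists>h\<in>K. h s = Some s" if s: "\<forall>A\<in>G. point_character S s A = \<chi> A" for s
  proof -
    have eq: "point_character S s A = \<chi> A" if "A \<in> insert X \<X>" for A
      using s that unfolding G_def by blast
    have "s \<in> X"
      using eq[OF insertI1] \<chi>(2) point_character_apply[OF X, of s] by (metis zero_neq_one)
    moreover have "s \<notin> A" if "A \<in> \<X>" for A
      using eq[OF insertI2[OF that]] \<chi>(3)[OF that] point_character_apply[OF subsetD[OF \<X>(2) that], of s]
      by (metis zero_neq_one)
    ultimately have "s \<in> X - \<Union>\<X>"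
      by blast
    then obtain h where h: "h \<in> H" "h s = Some s"
      using cover by auto
    have "h \<in> K"
    proof (rule ccontr)
      assume "h \<notin> K"
      then have "h \<in> H - K" "\<forall>A\<in>F h. point_character S s A = \<chi> A"
        using h s by (auto simp: G_def)
      then show False
        using F h(2) by blast
    qed
    then show ?thesis
      using h(2) by blast
  qed
  \<comment> \<open>A fixed point of \<open>h\<close> lies in \<open>dom h\<close>, so the value 1
    there passes to \<open>\<chi>\<close>.\<close>
  have dom1: "\<chi> (dom h) = 1" if h: "h \<in> K" for h
  proof -
    have J: "dom h \<in> ?J"
      using dom_constructible h K by blast
    then obtain s where "h s = Some s" "point_character S s (dom h) = \<chi> (dom h)"
      using h unfolding K_def by (auto dest: spec[of _ "{dom h}"])
    then show ?thesis
      using J by (auto simp: domI split: if_splits)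
  qed
  have iso: "germ S h \<chi> \<in> isotropy S \<chi> - {gpd_unit S \<chi>}" if h: "h \<in> K" for h
  proof -
    have pair: "(h, \<chi>) \<in> germ_pairs S"
      using h K \<chi>(1) dom1 by (intro germ_pairsI) auto
    have "push_character S h \<chi> = \<chi>"
      using h K by (intro push_character_fixed[OF _ char]) (auto simp: K_def)
    then have "germ S h \<chi> \<in> isotropy S \<chi>"
      using pair by (simp add: isotropy_def germ_in_gpd gpd_source_germ gpd_range_germ)
    moreover have "germ S h \<chi> \<noteq> gpd_unit S \<chi>"
    proof
      assume "germ S h \<chi> = gpd_unit S \<chi>"
      then obtain A where A: "A \<in> ?J" "\<chi> A = 1" "\<forall>x\<in>A. h x = partial_id (carrier S) x"
        using germ_eqD[OF pair unit_germ_pair[OF \<chi>(1)]] by (auto simp: gpd_unit_def)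
      then have "\<forall>x\<in>A. h x = Some x"
        using constructible_subset[OF A(1)] by (auto simp: partial_id_def)
      then show False
        using avoid[OF A(1)] A(2) h K(2) by auto
    qed
    ultimately show ?thesis
      by simp
  qed
  obtain e where e: "bij_betw e {1..card K} K"
    using ex_bij_betw_nat_finite_1[OF K(1)] by blast
  then have eK: "e ` {1..card K} = K"
    by (simp add: bij_betw_def)
  \<comment> \<open>A point character matching \<open>\<chi>\<close> on \<open>G\<close> exists, and
    its point is fixed by an element of \<open>K\<close>; this gives at least one germ, as (C)
    demands.\<close>
  have "K \<noteq> {}"
    using \<chi>(1) G fixing unfolding spectrum_iff by blast
  then have "card K \<ge> 1"
    using K(1) by (simp add: Suc_le_eq card_gt_0_iff)
  define B where "B h = germ S h ` {\<psi> \<in> spectrum S. \<psi> (dom h) = 1}" for h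
  define U where "U = {\<psi> \<in> spectrum S. \<forall>A\<in>G. \<psi> A = \<chi> A}"
  have "openin (spectrum_topology S) U"
    unfolding U_def by (rule openin_spectrum_cylinder[OF G])
  moreover have "\<chi> \<in> U" "U \<subseteq> spectrum S"
    using \<chi>(1) by (auto simp: U_def)
  moreover have "gpd_unit S ` (point_characters S \<inter> U) \<subseteq> (\<Union>k\<in>{1..card K}. B (e k))"
  proof (intro image_subsetI)
    fix \<psi> assume \<psi>: "\<psi> \<in> point_characters S \<inter> U"
    then obtain s where s: "s \<in> carrier S" "\<psi> = point_character S s"
      by blast
    then obtain h where h: "h \<in> K" "h s = Some s"
      using fixing \<psi> by (auto simp: U_def)
    \<comment> \<open>The principal ideal of \<open>s\<close> witnesses equality of the germs: it
      has value 1 at \<open>\<psi>\<close>, and \<open>h\<close> fixes it pointwise.\<close>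
    let ?P = "(\<otimes>) s ` carrier S"
    have \<psi>s: "\<psi> \<in> spectrum S"
      using \<psi> by (simp add: U_def)
    have hull: "h \<in> left_inverse_hull S"
      using h(1) K by blast
    have "\<psi> (dom h) = 1"
      using dom_constructible[OF hull] h(2) s by (auto simp: domI)
    moreover have "?P \<in> ?J" "\<psi> ?P = 1"
      using principal_constructible[OF s(1)] self_mem_principal[OF s(1)] s by auto
    moreover have "?P \<subseteq> carrier S"
      using s(1) by auto
    ultimately have "gpd_unit S \<psi> = germ S h \<psi>"
      unfolding gpd_unit_def using hull unit_germ_pair[OF \<psi>s] fixed_principal[OF hull h(2)]
      by (intro germ_eqI[of _ _ _ ?P])
         (auto simp del: imageE simp: germ_pairs_def partial_id_def restrict_map_def)
    then have "gpd_unit S \<psi> \<in> B h"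
      using \<psi>s \<open>\<psi> (dom h) = 1\<close> by (simp add: B_def)
    moreover obtain k where "k \<in> {1..card K}" "h = e k"
      using h(1) eK by (metis imageE)
    ultimately show "gpd_unit S \<psi> \<in> (\<Union>k\<in>{1..card K}. B (e k))"
      by blast
  qed
  moreover have "germ S (e k) \<chi> \<in> isotropy S \<chi> - {gpd_unit S \<chi>} \<and> openin (gpd_topology S) (B (e k)) \<and>
      bisection S (B (e k)) \<and> germ S (e k) \<chi> \<in> B (e k)" if "k \<in> {1..card K}" for k
  proof -
    have k: "e k \<in> K"
      using that eK by blast
    then show ?thesis
      using iso[OF k] basic_bisection[of "e k"] K(3) dom1[OF k] \<chi>(1) unfolding B_def by blast
  qed
  ultimately show ?thesis
    unfolding condition_C_def using \<open>card K \<ge> 1\<close>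
    by (intro exI[of _ "card K"] exI[of _ "\<lambda>k. germ S (e k) \<chi>"] exI[of _ "\<lambda>k. B (e k)"] exI[of _ U]) blast
qed

lemma not_condition_C_imp_regular:
  assumes nC: "\<forall>\<chi>\<in>boundary_spectrum S - point_characters S. \<not> condition_C S \<chi>"
  shows "strongly_regular_on_boundary S"
  unfolding strongly_regular_on_boundary_def
proof (intro allI impI, elim conjE, rule ccontr)
  fix H X \<X>
  assume H: "finite H" "H \<subseteq> left_inverse_hull S" and X: "X \<in> constructible_ideals S"
    and \<X>: "finite \<X>" "\<X> \<subseteq> constructible_ideals S" "\<forall>A\<in>\<X>. A \<subseteq> X"
    and cover: "X - \<Union>\<X> \<subseteq> (\<Union>h\<in>H. {s \<in> carrier S. h s = Some s})"
    and none: "\<nexists>\<Y>. finite \<Y> \<and> \<Y> \<subseteq> constructible_ideals S \<and>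
            (\<forall>Y\<in>\<Y>. \<exists>h\<in>H. h \<circ>\<^sub>m partial_id Y = partial_id Y) \<and>
            foundation_set S (\<X> \<union> \<Y>) X"
  obtain \<chi> where \<chi>: "\<chi> \<in> boundary_spectrum S" "\<chi> X = 1" "\<And>A. A \<in> \<X> \<Longrightarrow> \<chi> A = 0"
    "\<And>Y h. \<lbrakk>Y \<in> constructible_ideals S; h \<in> H; \<forall>y\<in>Y. h y = Some y\<rbrakk> \<Longrightarrow> \<chi> Y = 0"
    using boundary_character_avoiding_fixed[OF X \<X> none] by blast
  \<comment> \<open>If \<open>\<chi>\<close> came from \<open>s\<close>, then \<open>s\<close> would
    lie in the covered set and be fixed by some \<open>h\<close> in \<open>H\<close>, so
    \<open>sS\<close> would be a fixed ideal with value 1 at \<open>\<chi>\<close>.\<close>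
  have "\<chi> \<notin> point_characters S"
  proof
    assume "\<chi> \<in> point_characters S"
    then obtain s where s: "s \<in> carrier S" "\<chi> = point_character S s"
      by blast
    then have "s \<in> X"
      using \<chi>(2) X by (simp split: if_splits)
    moreover have "s \<notin> A" if "A \<in> \<X>" for A
      using \<chi>(3)[OF that] s(2) subsetD[OF \<X>(2) that] by (simp split: if_splits)
    ultimately have "s \<in> X - \<Union>\<X>"
      by blast
    then obtain h where h: "h \<in> H" "h s = Some s"
      using cover by auto
    let ?P = "(\<otimes>) s ` carrier S"
    have "\<forall>t\<in>?P. h t = Some t"
      using fixed_principal h H(2) by blast
    then have "\<chi> ?P = 0"
      using \<chi>(4)[OF principal_constructible[OF s(1)] h(1)] by blast
    then show False
      using s principal_constructible[OF s(1)] self_mem_principal[OF s(1)] by simp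
  qed
  moreover have "condition_C S \<chi>"
    by (rule condition_C_of_fixed_points[OF H X \<X>(1,2) cover]) (use \<chi> in \<open>simp_all add: boundary_iff\<close>)
  ultimately show False
    using nC \<chi>(1) by blast
qed

end

theorem lemma2p11:
  fixes S :: "('a, 'b) monoid_scheme"
  assumes "left_cancellative_monoid S"
  shows "(\<forall>\<chi> \<in> boundary_spectrum S - point_characters S. \<not> condition_C S \<chi>)
           \<longleftrightarrow> strongly_regular_on_boundary S"
  using left_cancellative_monoid.regular_imp_not_condition_C[OF assms]
    left_cancellative_monoid.not_condition_C_imp_regular[OF assms] by blast

end
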